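(* Let the sequence $\{\mathcal W^t\}_{t=0}^T$, $\mathcal W^t=\{x^{t+1},x^t,\check y^{t+1},y^t,z^{t+1},z^t\}$, be generated by FADMM-D (with $d$ being $W_d$-weakly convex) or by FADMM-Q (with $\sqrt d$ being $W_d$-weakly convex), under the standing assumptions listed in the context. If $p\in(0,1)$, then $$\mathrm{Crit}(\mathcal W^t)\le\mathcal O(T^{-p})+\mathcal O(T^{(p-1)/2}).$$ In particular, with the choice $p=1/3$, $\mathrm{Crit}(\mathcal W^t)\le\mathcal O(T^{-1/3})$. In other words, there exists $\bar t$ with $1\le\bar t\le T$ such that $\mathrm{Crit}(\mathcal W^{\bar t})\le\epsilon$, provided that $T\ge\mathcal O(1/\epsilon^3)$.
   Context: Problem. $\min_{x\in\mathbb R^n}F(x)=u(x)/d(x)$ with $u(x)=f(x)+\delta(x)-g(x)+h(Ax)$, $A\in\mathbb R^{m\times n}$. $\|\cdot\|$ is the Euclidean norm for vectors and the spectral norm for matrices; $\partial$ is the limiting subdifferential. A function $\varphi$ is $W$-weakly convex if $\varphi+\frac W2\|\cdot\|^2$ is convex. Standing assumptions on the problem: $f:\mathbb R^n\to\mathbb R$ is differentiable with $L_f$-Lipschitz gradient; $\delta:\mathbb R^n\to(-\infty,+\infty]$ is proper and lower semicontinuous (possibly nonconvex); $g:\mathbb R^n\to\mathbb R$ is convex; $h:\mathbb R^m\to\mathbb R$ is convex and $C_h$-Lipschitz; $d:\mathbb R^n\to[0,\infty)$ is $C_d$-Lipschitz; $u\ge0$; the proximal operators of $\delta$ and $h$ can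 be computed exactly; there is $\overline{\mathrm x}>0$ with $\|x\|\le\overline{\mathrm x}$ for all $x\in\mathrm{dom}(F)=\{x:F(x)<+\infty\}$. $W_d\ge 0$ is a constant. Smoothing. For $\mu>0$, $h_\mu(y)=\max_v\{\langle y,v\rangle-h^*(v)-\frac\mu2\|v\|^2\}$, with $h^*$ the convex conjugate; $\mathrm{Prox}(b;h,\mu)=\arg\min_y h(y)+\frac1{2\mu}\|y-b\|^2$. Put $\mathcal U(x,y;z;\beta,\mu)=f(x)+\langle Ax-y,z\rangle+\frac\beta2\|Ax-y\|^2+\delta(x)-g(x)+h_\mu(y)$. Algorithm (FADMM). Parameters $\xi\in(0,\infty)$, $\theta\in(1,\infty)$, $p\in(0,1)$, $\chi\in(2\sqrt{1+\xi},\infty)$, $\beta^0>0$; $\beta^t=\beta^0(1+\xi t^p)$, $\mu^t=\chi/\beta^t$ (superscripts on iterates and parameters are indices, $t^p$ is a power, $0^p=0$). Start from $x^0\in\mathrm{dom}(F)$, $y^0,z^0\in\mathbb R^m$. For $t=0,1,2,\dots$ let $s_t(x)=f(x)+\langle Ax-y^t,z^t\rangle+\frac{\beta^t}2\|Ax-y^t\|^2$. - FADMM-D: $\lambda^t=\mathcal U(x^t,y^t;z^t;\beta^t,\mu^t)/d(x^t)$, $\ell(\beta^t)=L_f+\beta^t\|A\|^2+\lambda^tW_d$; choose $\zeta_g\in\partial g(x^t)$, $\zeta_d\in\partial d(x^t)$ and $x^{t+1}\in\arg\min_x\ \delta(x)+\langle x-x^t,\nabla s_t(x^t)-\zeta_g-\lambda^t\zeta_d\rangle+\frac{\theta\ell(\beta^t)}2\|x-x^t\|^2$.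 - FADMM-Q: $\alpha^{t+1}=\sqrt{d(x^t)}/\mathcal U(x^t,y^t;z^t;\beta^t,\mu^t)$, $\ell(\beta^t)=L_f+\beta^t\|A\|^2+\frac2{\alpha^{t+1}}W_d$; choose $\zeta_g\in\partial g(x^t)$, $\zeta\in\partial\sqrt{d}(x^t)$ and $x^{t+1}\in\arg\min_x\ \delta(x)+\langle x-x^t,\nabla s_t(x^t)-\zeta_g-\frac2{\alpha^{t+1}}\zeta\rangle+\frac{\theta\ell(\beta^t)}2\|x-x^t\|^2$. Then, in both variants, with $b^t=Ax^{t+1}+z^t/\beta^t$: $\check y^{t+1}=\mathrm{Prox}(b^t;h,\mu^t+1/\beta^t)$, $y^{t+1}=\arg\min_y h_{\mu^t}(y)+\frac{\beta^t}2\|y-b^t\|^2$ (equivalently $y^{t+1}=\frac{\check y^{t+1}+\beta^t\mu^tb^t}{1+\beta^t\mu^t}$), and $z^{t+1}=z^t+\beta^t(Ax^{t+1}-y^{t+1})$. Standing assumptions on the iterates: there are constants with $0<\underline{\mathrm d}\le d(x^t)\le\overline{\mathrm d}$ and $0<\underline{\mathrm F}\le F(x^t)\le\overline{\mathrm F}$ for all $t$; with $\overline{\mathrm z}=\max(\|z^0\|,C_h)$ and $\underline{\mathrm v}=8\overline{\mathrm z}^2+\frac12\chi\overline{\mathrm z}^2$, one has $\beta^0>\underline{\mathrm v}/(\underline{\mathrm F}\,\underline{\mathrm d})$. Criticality measure. $\varphi(x,y)=\{f(x)+\delta(x)-g(x)+h(y)\}/d(x)$ and $\mathrm{Crit}(x^+,x,y^+,y,z^+,z)=\|x^+-x\|+\|y^+-y\|+\|z^+-z\|+\|Ax^+-y^+\|+\|\partial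 h(y^+)-z^+\|+\|\partial\delta(x^+)+\nabla f(x^+)-\partial g(x)+A^{\mathsf T}z^+-\varphi(x,y)\partial d(x)\|$, where the norm of a set is the distance from $0$ to the set and sums/differences of sets are Minkowski sums/differences. A tuple with $\mathrm{Crit}\le\epsilon$ is called an $\epsilon$-critical point. Constants in $\mathcal O(\cdot)$ do not depend on $T$ or $\epsilon$.
   Formalization: The formal theorem additionally assumes that A is nonzero or L_f > 0 or W_d > 0; if all three vanish then ℓ(β^t) = 0, the x-step has no proximal term, and the claim fails (e.g. f = d = 1, g = h = 0, A = 0, δ the indicator of [-1,1]). *)

theory Defs
  imports "HOL-Analysis.Analysis"
begin

section \<open>Variational analysis\<close>

definition proper_fun :: "('a \<Rightarrow> ereal) \<Rightarrow> bool" where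
  "proper_fun \<phi> \<longleftrightarrow> (\<forall>x. \<phi> x \<noteq> -\<infinity>) \<and> (\<exists>x. \<phi> x \<noteq> \<infinity>)"

definition lower_semicont :: "('a::topological_space \<Rightarrow> ereal) \<Rightarrow> bool" where
  "lower_semicont \<phi> \<longleftrightarrow> (\<forall>x. \<phi> x \<le> Liminf (at x) \<phi>)"

definition weakly_convex :: "real \<Rightarrow> ('a::real_inner \<Rightarrow> real) \<Rightarrow> bool" where
  "weakly_convex W \<phi> \<longleftrightarrow> convex_on UNIV (\<lambda>x. \<phi> x + W / 2 * (norm x)\<^sup>2)"

definition gradient :: "('a::real_inner \<Rightarrow> real) \<Rightarrow> 'a \<Rightarrow> 'a" where
  "gradient \<phi> x = (THE D. GDERIV \<phi> x :> D)"

definition frechet_subdiff :: "('a::euclidean_space \<Rightarrow> ereal) \<Rightarrow> 'a \<Rightarrow> 'a set" where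
  "frechet_subdiff \<phi> x = {v. \<bar>\<phi> x\<bar> \<noteq> \<infinity> \<and>
     0 \<le> Liminf (at x) (\<lambda>y. (\<phi> y - \<phi> x - ereal (v \<bullet> (y - x))) / ereal (norm (y - x)))}"

definition limiting_subdiff :: "('a::euclidean_space \<Rightarrow> ereal) \<Rightarrow> 'a \<Rightarrow> 'a set" where
  "limiting_subdiff \<phi> x = {v. \<bar>\<phi> x\<bar> \<noteq> \<infinity> \<and>
     (\<exists>xs vs. xs \<longlonglongrightarrow> x \<and> (\<lambda>k. \<phi> (xs k)) \<longlonglongrightarrow> \<phi> x \<and>
        (\<forall>k. vs k \<in> frechet_subdiff \<phi> (xs k)) \<and> vs \<longlonglongrightarrow> v)}"

abbreviation subdiff :: "('a::euclidean_space \<Rightarrow> real) \<Rightarrow> 'a \<Rightarrow> 'a set" where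
  "subdiff \<phi> \<equiv> limiting_subdiff (\<lambda>x. ereal (\<phi> x))"

text \<open>The distance from 0 to \<open>S\<close>. Unlike \<^const>\<open>infdist\<close>, which is 0 on the empty set, this
  gives \<open>\<infinity>\<close> there.\<close>

definition set_norm :: "'a::real_normed_vector set \<Rightarrow> ereal" where
  "set_norm S = (INF v\<in>S. ereal (norm v))"

definition convex_conjugate :: "('a::real_inner \<Rightarrow> real) \<Rightarrow> 'a \<Rightarrow> ereal" where
  "convex_conjugate h v = (SUP y. ereal (y \<bullet> v - h y))"

text \<open>The supremum is a maximum, and finite, whenever \<open>h\<close> is convex and Lipschitz and
  \<open>\<mu> > 0\<close>.\<close>

definition smoothed :: "('a::real_inner \<Rightarrow> real) \<Rightarrow> real \<Rightarrow> 'a \<Rightarrow> ereal" where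
  "smoothed h \<mu> y =
     (SUP v. ereal (y \<bullet> v) - convex_conjugate h v - ereal (\<mu> / 2 * (norm v)\<^sup>2))"

definition argmin_set :: "('a \<Rightarrow> 'b::linorder) \<Rightarrow> 'a set" where
  "argmin_set \<phi> = {x. is_arg_min \<phi> (\<lambda>_. True) x}"

definition Prox :: "'a::real_inner \<Rightarrow> ('a \<Rightarrow> real) \<Rightarrow> real \<Rightarrow> 'a set" where
  "Prox b h \<mu> = argmin_set (\<lambda>y. h y + 1 / (2 * \<mu>) * (norm (y - b))\<^sup>2)"


section \<open>The fractional program\<close>

definition numer ::
  "(real^'n \<Rightarrow> real) \<Rightarrow> (real^'n \<Rightarrow> ereal) \<Rightarrow> (real^'n \<Rightarrow> real) \<Rightarrow> (real^'m \<Rightarrow> real) \<Rightarrow>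
   real^'n^'m \<Rightarrow> real^'n \<Rightarrow> ereal" where
  "numer f \<delta> g h A x = ereal (f x) + \<delta> x - ereal (g x) + ereal (h (A *v x))"

text \<open>The value is \<open>+\<infinity>\<close> wherever the denominator vanishes, also when the numerator does;
  the division of \<^typ>\<open>ereal\<close> would give \<open>0 / 0 = 0\<close>.\<close>

definition frac_obj ::
  "(real^'n \<Rightarrow> real) \<Rightarrow> (real^'n \<Rightarrow> ereal) \<Rightarrow> (real^'n \<Rightarrow> real) \<Rightarrow> (real^'m \<Rightarrow> real) \<Rightarrow>
   (real^'n \<Rightarrow> real) \<Rightarrow> real^'n^'m \<Rightarrow> real^'n \<Rightarrow> ereal" where
  "frac_obj f \<delta> g h d A x =
     (if d x = 0 then \<infinity> else numer f \<delta> g h A x / ereal (d x))"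

definition smooth_part ::
  "(real^'n \<Rightarrow> real) \<Rightarrow> real^'n^'m \<Rightarrow> real^'m \<Rightarrow> real^'m \<Rightarrow> real \<Rightarrow> real^'n \<Rightarrow> real" where
  "smooth_part f A y z \<beta> x =
     f x + (A *v x - y) \<bullet> z + \<beta> / 2 * (norm (A *v x - y))\<^sup>2"

definition smoothed_lagrangian ::
  "(real^'n \<Rightarrow> real) \<Rightarrow> (real^'n \<Rightarrow> ereal) \<Rightarrow> (real^'n \<Rightarrow> real) \<Rightarrow> (real^'m \<Rightarrow> real) \<Rightarrow>
   real^'n^'m \<Rightarrow> real^'n \<Rightarrow> real^'m \<Rightarrow> real^'m \<Rightarrow> real \<Rightarrow> real \<Rightarrow> ereal" where
  "smoothed_lagrangian f \<delta> g h A x y z \<beta> \<mu> =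
     ereal (smooth_part f A y z \<beta> x) + \<delta> x - ereal (g x) + smoothed h \<mu> y"


section \<open>The algorithm\<close>

datatype fadmm_variant = FADMM_D | FADMM_Q

text \<open>Both variants linearise \<open>- w q\<close> at the current point \<open>x\<close>. With \<open>U\<close> the current value of
  the smoothed Lagrangian, FADMM-D takes \<open>q = d\<close> and \<open>w = \<lambda> = U / d x\<close>, and FADMM-Q takes
  \<open>q = sqrt d\<close> and \<open>w = 2 / \<alpha>\<close> with \<open>\<alpha> = sqrt (d x) / U\<close>.\<close>

definition denom_part :: "fadmm_variant \<Rightarrow> ('a \<Rightarrow> real) \<Rightarrow> 'a \<Rightarrow> real" where
  "denom_part var d = (case var of FADMM_D \<Rightarrow> d | FADMM_Q \<Rightarrow> (\<lambda>x. sqrt (d x)))"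

definition denom_weight :: "fadmm_variant \<Rightarrow> real \<Rightarrow> real \<Rightarrow> real" where
  "denom_weight var U dx =
     (case var of FADMM_D \<Rightarrow> U / dx | FADMM_Q \<Rightarrow> 2 / (sqrt dx / U))"

text \<open>The matrix norm is the spectral one, i.e. \<^const>\<open>onorm\<close>; the \<^const>\<open>norm\<close> of a matrix
  is its Frobenius norm.\<close>

definition x_update ::
  "(real^'n \<Rightarrow> real) \<Rightarrow> (real^'n \<Rightarrow> ereal) \<Rightarrow> (real^'n \<Rightarrow> real) \<Rightarrow> real^'n^'m \<Rightarrow>
   real \<Rightarrow> real \<Rightarrow> real \<Rightarrow> (real^'n \<Rightarrow> real) \<Rightarrow> real \<Rightarrow>
   real^'n \<Rightarrow> real^'m \<Rightarrow> real^'m \<Rightarrow> real \<Rightarrow> real^'n \<Rightarrow> bool" where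
  "x_update f \<delta> g A L\<^sub>f W\<^sub>d \<theta> q w x y z \<beta> x' \<longleftrightarrow>
     (\<exists>\<zeta>\<^sub>g \<in> subdiff g x. \<exists>\<zeta>\<^sub>q \<in> subdiff q x.
        x' \<in> argmin_set (\<lambda>u. \<delta> u + ereal (
               (u - x) \<bullet> (gradient (smooth_part f A y z \<beta>) x - \<zeta>\<^sub>g - w *\<^sub>R \<zeta>\<^sub>q)
             + \<theta> * (L\<^sub>f + \<beta> * (onorm (\<lambda>v. A *v v))\<^sup>2 + w * W\<^sub>d) / 2 * (norm (u - x))\<^sup>2)))"

text \<open>\<open>0 powr p = 0\<close>, as required at \<open>t = 0\<close>.\<close>

definition penalty :: "real \<Rightarrow> real \<Rightarrow> real \<Rightarrow> nat \<Rightarrow> real" where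
  "penalty \<beta>\<^sub>0 \<xi> p t = \<beta>\<^sub>0 * (1 + \<xi> * real t powr p)"

text \<open>\<open>yc\<close> is the sequence of the proximal points; the entry \<open>yc 0\<close> is unused.\<close>

definition fadmm_run ::
  "fadmm_variant \<Rightarrow> (real^'n \<Rightarrow> real) \<Rightarrow> (real^'n \<Rightarrow> ereal) \<Rightarrow> (real^'n \<Rightarrow> real) \<Rightarrow>
   (real^'m \<Rightarrow> real) \<Rightarrow> (real^'n \<Rightarrow> real) \<Rightarrow> real^'n^'m \<Rightarrow>
   real \<Rightarrow> real \<Rightarrow> real \<Rightarrow> real \<Rightarrow> real \<Rightarrow> real \<Rightarrow> real \<Rightarrow>
   (nat \<Rightarrow> real^'n) \<Rightarrow> (nat \<Rightarrow> real^'m) \<Rightarrow> (nat \<Rightarrow> real^'m) \<Rightarrow> (nat \<Rightarrow> real^'m) \<Rightarrow> bool" where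
  "fadmm_run var f \<delta> g h d A L\<^sub>f W\<^sub>d \<theta> \<xi> p chi \<beta>\<^sub>0 x yc y z \<longleftrightarrow>
     (\<forall>t. let \<beta> = penalty \<beta>\<^sub>0 \<xi> p t;
              \<mu> = chi / \<beta>;
              U = real_of_ereal (smoothed_lagrangian f \<delta> g h A (x t) (y t) (z t) \<beta> \<mu>);
              b = A *v x (Suc t) + (1 / \<beta>) *\<^sub>R z t
          in x_update f \<delta> g A L\<^sub>f W\<^sub>d \<theta> (denom_part var d) (denom_weight var U (d (x t)))
               (x t) (y t) (z t) \<beta> (x (Suc t)) \<and>
             yc (Suc t) \<in> Prox b h (\<mu> + 1 / \<beta>) \<and>
             y (Suc t) \<in> argmin_set (\<lambda>v. smoothed h \<mu> v + ereal (\<beta> / 2 * (norm (v - b))\<^sup>2)) \<and>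
             z (Suc t) = z t + \<beta> *\<^sub>R (A *v x (Suc t) - y (Suc t)))"


section \<open>The criticality measure\<close>

definition split_ratio ::
  "(real^'n \<Rightarrow> real) \<Rightarrow> (real^'n \<Rightarrow> ereal) \<Rightarrow> (real^'n \<Rightarrow> real) \<Rightarrow> (real^'m \<Rightarrow> real) \<Rightarrow>
   (real^'n \<Rightarrow> real) \<Rightarrow> real^'n \<Rightarrow> real^'m \<Rightarrow> real" where
  "split_ratio f \<delta> g h d x y =
     real_of_ereal (ereal (f x) + \<delta> x - ereal (g x) + ereal (h y)) / d x"

definition crit ::
  "(real^'n \<Rightarrow> real) \<Rightarrow> (real^'n \<Rightarrow> ereal) \<Rightarrow> (real^'n \<Rightarrow> real) \<Rightarrow> (real^'m \<Rightarrow> real) \<Rightarrow>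
   (real^'n \<Rightarrow> real) \<Rightarrow> real^'n^'m \<Rightarrow>
   real^'n \<Rightarrow> real^'n \<Rightarrow> real^'m \<Rightarrow> real^'m \<Rightarrow> real^'m \<Rightarrow> real^'m \<Rightarrow> ereal" where
  "crit f \<delta> g h d A x' x y' y z' z =
     ereal (norm (x' - x)) + ereal (norm (y' - y)) + ereal (norm (z' - z))
   + ereal (norm (A *v x' - y'))
   + set_norm {\<zeta>\<^sub>h - z' | \<zeta>\<^sub>h. \<zeta>\<^sub>h \<in> subdiff h y'}
   + set_norm {\<zeta>\<^sub>\<delta> + gradient f x' - \<zeta>\<^sub>g + transpose A *v z' - split_ratio f \<delta> g h d x y *\<^sub>R \<zeta>\<^sub>d
       | \<zeta>\<^sub>\<delta> \<zeta>\<^sub>g \<zeta>\<^sub>d. \<zeta>\<^sub>\<delta> \<in> limiting_subdiff \<delta> x' \<and> \<zeta>\<^sub>g \<in> subdiff g x \<and> \<zeta>\<^sub>d \<in> subdiff d x}"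

end

theory Submission
  imports Defs
begin

text \<open>
  Write \<open>U t\<close> for the smoothed Lagrangian at the current iterate. Optimality of the \<open>x\<close>-step makes
  \<open>U / d\<close> drop by a multiple of \<open>ell t * (dx t)\<^sup>2\<close>, for both variants, and strong convexity of the
  \<open>y\<close>-subproblem makes \<open>U\<close> drop by \<open>\<beta> t / 2 * (dy t)\<^sup>2\<close>. The multiplier step costs
  \<open>(dz t)\<^sup>2 / \<beta> t\<close>; as \<open>z (t + 1)\<close> is the gradient of the Moreau envelope of \<open>h\<close> at \<open>y (t + 1)\<close>, this is a
  fraction of \<open>\<beta> t * (dy t)\<^sup>2\<close>, smaller than \<open>1 / 2\<close> because \<open>chi > 2 * sqrt (1 + \<xi>)\<close>, up to
  drift terms in \<open>1 / \<beta> t\<close> which telescope. Hence \<open>\<Sum>t. ell t * (dx t)\<^sup>2 + \<beta> t * (dy t)\<^sup>2\<close> is bounded.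
  The criticality measure is at most a multiple of \<open>ell t * dx t + \<beta> t * dy t + 1 / \<beta> t\<close>, and \<open>ell t\<close> and \<open>\<beta> t\<close>
  grow at most like \<open>t powr p\<close>, so a good index is found by averaging over the second half
  of \<open>{1..T}\<close>.
\<close>


section \<open>Subgradients\<close>

text \<open>The criticality measure contains \<open>ell t * dx t\<close>, whereas the summable
  quantity is \<open>ell t * (dx t)\<^sup>2\<close>. Squaring the former leaves a spare factor of
  order \<open>T powr p\<close> against the average \<open>1 / T\<close>, which is the origin of the
  exponent \<open>(p - 1) / 2\<close>. The exponent \<open>- p\<close> comes from smoothing,
  infeasibility and parameter drift, all multiples of \<open>1 / \<beta> t\<close>; averaging does
  not improve these, so they must be small at the selected index itself, which forces that index to
  be comparable to \<open>T\<close>. Two obstacles shape the rest. \<delta> may be nonconvex, so its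
  subgradient is read off a quadratic minorant at the minimiser. And \<open>y0\<close> is arbitrary,
  so the residual \<open>A *v x t - y t\<close> is controlled only after one step; upper bounds and
  sums therefore start at index 1.\<close>

lemma frechet_subdiff_real_iff:
  "v \<in> frechet_subdiff (\<lambda>u. ereal (q u)) x \<longleftrightarrow>
     (\<forall>\<epsilon>>0. \<forall>\<^sub>F u in at x. q x + v \<bullet> (u - x) - \<epsilon> * norm (u - x) \<le> q u)"
proof -
  have ne: "\<forall>\<^sub>F u in at x. u \<noteq> x"
    by (simp add: eventually_at_filter)
  \<comment> \<open>At \<open>u = x\<close> both quotients are 0 / 0, which is 0 in ereal as in the
    reals.\<close>
  have quot: "(ereal (q u) - ereal (q x) - ereal (v \<bullet> (u - x))) / ereal (norm (u - x))
      = ereal ((q u - q x - v \<bullet> (u - x)) / norm (u - x))" for u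
    by (cases "u = x") (auto simp: zero_ereal_def)
  have "v \<in> frechet_subdiff (\<lambda>u. ereal (q u)) x \<longleftrightarrow>
     (\<forall>c<0. \<forall>\<^sub>F u in at x. c < ereal ((q u - q x - v \<bullet> (u - x)) / norm (u - x)))"
    unfolding frechet_subdiff_def le_Liminf_iff mem_Collect_eq quot by simp
  also have "\<dots> \<longleftrightarrow> (\<forall>\<epsilon>>0. \<forall>\<^sub>F u in at x. - \<epsilon> \<le> (q u - q x - v \<bullet> (u - x)) / norm (u - x))"
    (is "?L \<longleftrightarrow> ?R")
  proof
    assume L: ?L
    show ?R
    proof (intro allI impI)
      fix \<epsilon> :: real assume "\<epsilon> > 0"
      then have "ereal (- \<epsilon>) < 0" by simp
      with L have "\<forall>\<^sub>F u in at x. ereal (-\<epsilon>) < ereal ((q u - q x - v \<bullet> (u - x)) / norm (u - x))"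
        by blast
      then show "\<forall>\<^sub>F u in at x. - \<epsilon> \<le> (q u - q x - v \<bullet> (u - x)) / norm (u - x)"
        by eventually_elim simp
    qed
  next
    assume R: ?R
    show ?L
    proof (intro allI impI)
      fix c :: ereal assume "c < 0"
      then obtain r where r: "c < ereal r" "ereal r < 0"
        using ereal_dense2 by blast
      then have "0 < - r" by (simp add: zero_ereal_def)
      with R have "\<forall>\<^sub>F u in at x. - (- r) \<le> (q u - q x - v \<bullet> (u - x)) / norm (u - x)"
        by blast
      then show "\<forall>\<^sub>F u in at x. c < ereal ((q u - q x - v \<bullet> (u - x)) / norm (u - x))"
        by eventually_elim (use r in \<open>auto intro: less_le_trans\<close>)
    qed
  qed
  also have "\<dots> \<longleftrightarrow> (\<forall>\<epsilon>>0. \<forall>\<^sub>F u in at x. q x + v \<bullet> (u - x) - \<epsilon> * norm (u - x) \<le> q u)"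
  proof -
    have "(- \<epsilon> \<le> (q u - q x - v \<bullet> (u - x)) / norm (u - x)) \<longleftrightarrow>
        (q x + v \<bullet> (u - x) - \<epsilon> * norm (u - x) \<le> q u)" if "u \<noteq> x" for \<epsilon> u
      using that by (auto simp: field_simps)
    then have "(\<forall>\<^sub>F u in at x. - \<epsilon> \<le> (q u - q x - v \<bullet> (u - x)) / norm (u - x)) \<longleftrightarrow>
        (\<forall>\<^sub>F u in at x. q x + v \<bullet> (u - x) - \<epsilon> * norm (u - x) \<le> q u)" for \<epsilon>
      by (intro eventually_cong[OF ne]) auto
    then show ?thesis by simp
  qed
  finally show ?thesis .
qed

lemma limiting_subdiffI:
  assumes "\<bar>\<phi> x\<bar> \<noteq> \<infinity>" "xs \<longlonglongrightarrow> x" "(\<lambda>k. \<phi> (xs k)) \<longlonglongrightarrow> \<phi> x"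
    "\<And>k. vs k \<in> frechet_subdiff \<phi> (xs k)" "vs \<longlonglongrightarrow> v"
  shows "v \<in> limiting_subdiff \<phi> x"
  using assms unfolding limiting_subdiff_def by blast

lemma frechet_subset_limiting: "frechet_subdiff \<phi> x \<subseteq> limiting_subdiff \<phi> x"
proof
  fix v assume v: "v \<in> frechet_subdiff \<phi> x"
  then have "\<bar>\<phi> x\<bar> \<noteq> \<infinity>" by (simp add: frechet_subdiff_def)
  moreover have "(\<lambda>k::nat. x) \<longlonglongrightarrow> x" "(\<lambda>k::nat. \<phi> x) \<longlonglongrightarrow> \<phi> x" "(\<lambda>k::nat. v) \<longlonglongrightarrow> v" by auto
  ultimately show "v \<in> limiting_subdiff \<phi> x"
    using v by (intro limiting_subdiffI)
qed

text \<open>Dividing by \<open>norm (u - x)\<close> turns the quadratic error into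
  \<open>c * norm (u - x)\<close>, which vanishes in the liminf. Argmin conditions deliver exactly
  such a minorant, for nonconvex and extended-valued \<phi> too.\<close>

lemma quadratic_minorant_frechet:
  fixes \<phi> :: "'a::euclidean_space \<Rightarrow> ereal"
  assumes fin: "\<bar>\<phi> x\<bar> \<noteq> \<infinity>"
    and minor: "\<And>u. \<phi> x + ereal (v \<bullet> (u - x) - c * (norm (u - x))\<^sup>2) \<le> \<phi> u"
  shows "v \<in> frechet_subdiff \<phi> x"
proof -
  obtain r where r: "\<phi> x = ereal r" using fin by auto
  have lower: "ereal (- c * norm (u - x)) \<le> (\<phi> u - \<phi> x - ereal (v \<bullet> (u - x))) / ereal (norm (u - x))"
    if "u \<noteq> x" for u
  proof (cases "\<phi> u")
    case (real s)
    then have "r + (v \<bullet> (u - x) - c * (norm (u - x))\<^sup>2) \<le> s"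
      using minor[of u] r by simp
    then show ?thesis
      using that real r by (simp add: field_simps power2_eq_square)
  next
    case PInf
    then show ?thesis using that r by simp
  next
    case MInf
    then show ?thesis using minor[of u] r by simp
  qed
  have "\<forall>\<^sub>F u in at x. u \<noteq> x"
    by (simp add: eventually_at_filter)
  then have "Liminf (at x) (\<lambda>u. ereal (- c * norm (u - x)))
      \<le> Liminf (at x) (\<lambda>u. (\<phi> u - \<phi> x - ereal (v \<bullet> (u - x))) / ereal (norm (u - x)))"
    by (intro Liminf_mono) (auto elim!: eventually_mono dest!: lower)
  moreover have "((\<lambda>u. - c * norm (u - x)) \<longlongrightarrow> - c * norm (x - x)) (at x)"
    by (intro tendsto_intros)
  then have "((\<lambda>u. ereal (- c * norm (u - x))) \<longlongrightarrow> 0) (at x)"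
    by (simp add: zero_ereal_def)
  then have "Liminf (at x) (\<lambda>u. ereal (- c * norm (u - x))) = 0"
    by (intro lim_imp_Liminf) auto
  ultimately show ?thesis
    using fin by (simp add: frechet_subdiff_def)
qed

text \<open>\<open>at x\<close> is punctured, so the direction has to be nonzero for the ray to stay
  off \<open>x\<close>. Local subgradient inequalities thereby become one-sided limits in one real
  variable.\<close>

lemma eventually_at_ray:
  fixes x e :: "'a::real_normed_vector"
  assumes "\<forall>\<^sub>F u in at x. P u" "e \<noteq> 0"
  shows "\<forall>\<^sub>F s in at_right 0. P (x + s *\<^sub>R e)"
proof -
  have "((\<lambda>s. x + s *\<^sub>R e) \<longlongrightarrow> x + 0 *\<^sub>R e) (at_right 0)"
    by (intro tendsto_intros)
  moreover have "\<forall>\<^sub>F s in at_right 0. x + s *\<^sub>R e \<noteq> x"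
    using assms(2) by (auto simp: eventually_at_filter)
  ultimately have "filterlim (\<lambda>s. x + s *\<^sub>R e) (at x) (at_right 0)"
    by (simp add: filterlim_at)
  then show ?thesis
    using assms(1) by (rule eventually_compose_filterlim[rotated])
qed

text \<open>Convexity of the shifted function, combined with the exact identity for the squared norm
  of a convex combination, leaves the defect \<open>s * (1 - s)\<close>.\<close>

lemma weakly_convex_segment:
  assumes wc: "weakly_convex W q" and "0 \<le> s" "s \<le> 1"
  shows "q (x + s *\<^sub>R (y - x)) \<le> (1 - s) * q x + s * q y + W / 2 * (s * (1 - s)) * (norm (y - x))\<^sup>2"
proof -
  have "q ((1 - s) *\<^sub>R x + s *\<^sub>R y) + W / 2 * (norm ((1 - s) *\<^sub>R x + s *\<^sub>R y))\<^sup>2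
      \<le> (1 - s) * (q x + W / 2 * (norm x)\<^sup>2) + s * (q y + W / 2 * (norm y)\<^sup>2)"
    using convex_onD[OF wc[unfolded weakly_convex_def], of s x y] assms by simp
  moreover have "(1 - s) *\<^sub>R x + s *\<^sub>R y = x + s *\<^sub>R (y - x)"
    by (simp add: algebra_simps)
  moreover have "(norm ((1 - s) *\<^sub>R x + s *\<^sub>R y))\<^sup>2
     = (1 - s) * (norm x)\<^sup>2 + s * (norm y)\<^sup>2 - s * (1 - s) * (norm (y - x))\<^sup>2"
    unfolding power2_norm_eq_inner by (simp add: algebra_simps inner_commute)
  moreover have "W / 2 * ((1 - s) * (norm x)\<^sup>2 + s * (norm y)\<^sup>2 - s * (1 - s) * (norm (y - x))\<^sup>2)
     = (1 - s) * (W / 2 * (norm x)\<^sup>2) + s * (W / 2 * (norm y)\<^sup>2)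
       - W / 2 * (s * (1 - s)) * (norm (y - x))\<^sup>2"
    by (simp add: field_simps)
  ultimately show ?thesis by (simp add: distrib_left) argo
qed

text \<open>The local inequality is applied near \<open>x\<close> on the segment to
  \<open>y\<close>, and weak convexity carries it to \<open>y\<close>: both sides are divisible by
  \<open>s\<close>, and then \<open>s\<close> tends to 0.\<close>

lemma frechet_subgradient_weakly_convex:
  assumes wc: "weakly_convex W q" and v: "v \<in> frechet_subdiff (\<lambda>u. ereal (q u)) x"
  shows "q x + v \<bullet> (y - x) - W / 2 * (norm (y - x))\<^sup>2 \<le> q y"
proof (cases "y = x")
  case False
  show ?thesis
  proof (rule field_le_epsilon)
    fix e :: real assume e: "0 < e"
    \<comment> \<open>This scale makes the local error at parameter \<open>s\<close> exactly
      \<open>s * e\<close>, so that dividing by \<open>s\<close> leaves \<open>e\<close>.\<close>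
    define \<epsilon> where "\<epsilon> = e / norm (y - x)"
    have "\<epsilon> > 0" using e False by (simp add: \<epsilon>_def)
    then have "\<forall>\<^sub>F u in at x. q x + v \<bullet> (u - x) - \<epsilon> * norm (u - x) \<le> q u"
      using v by (simp add: frechet_subdiff_real_iff)
    then have ray: "\<forall>\<^sub>F s in at_right 0. q x + v \<bullet> (x + s *\<^sub>R (y - x) - x)
        - \<epsilon> * norm (x + s *\<^sub>R (y - x) - x) \<le> q (x + s *\<^sub>R (y - x))"
      using False by (intro eventually_at_ray) auto
    have "\<forall>\<^sub>F s in at_right (0::real). s \<in> {0<..<1}"
      by (rule eventually_at_right_real) simp
    with ray have "\<forall>\<^sub>F s in at_right 0.
        q x + v \<bullet> (y - x) - W / 2 * (1 - s) * (norm (y - x))\<^sup>2 - e \<le> q y"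
    proof eventually_elim
      case (elim s)
      have "\<epsilon> * norm (s *\<^sub>R (y - x)) = s * e"
        using elim False by (simp add: \<epsilon>_def)
      then have "s * (q x + v \<bullet> (y - x) - W / 2 * (1 - s) * (norm (y - x))\<^sup>2 - e) \<le> s * q y"
        using elim weakly_convex_segment[OF wc, of s x y] by (simp add: algebra_simps)
      then show ?case using elim by simp
    qed
    then have "q x + v \<bullet> (y - x) - W / 2 * (1 - 0) * (norm (y - x))\<^sup>2 - e \<le> q y"
    proof (rule tendsto_upperbound[rotated])
      show "((\<lambda>s. q x + v \<bullet> (y - x) - W / 2 * (1 - s) * (norm (y - x))\<^sup>2 - e) \<longlongrightarrow>
        q x + v \<bullet> (y - x) - W / 2 * (1 - 0) * (norm (y - x))\<^sup>2 - e) (at_right 0)"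
        by (intro tendsto_intros)
    qed simp
    then show "q x + v \<bullet> (y - x) - W / 2 * (norm (y - x))\<^sup>2 \<le> q y + e" by simp
  qed
qed simp

lemma subdiffE:
  assumes "v \<in> subdiff q x"
  obtains xs vs where "xs \<longlonglongrightarrow> x" "(\<lambda>k. q (xs k)) \<longlonglongrightarrow> q x"
    "\<And>k. vs k \<in> frechet_subdiff (\<lambda>u. ereal (q u)) (xs k)" "vs \<longlonglongrightarrow> v"
  using assms unfolding limiting_subdiff_def by auto

text \<open>Unlike the Frechet condition, the global inequality is closed under joint limits of base
  points, values and subgradients, so it reaches limiting subgradients.\<close>

lemma subgradient_weakly_convex:
  assumes wc: "weakly_convex W q" and v: "v \<in> subdiff q x"
  shows "q x + v \<bullet> (y - x) - W / 2 * (norm (y - x))\<^sup>2 \<le> q y"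
proof -
  obtain xs vs where lim: "xs \<longlonglongrightarrow> x" "(\<lambda>k. q (xs k)) \<longlonglongrightarrow> q x" "vs \<longlonglongrightarrow> v"
    and vs: "\<And>k. vs k \<in> frechet_subdiff (\<lambda>u. ereal (q u)) (xs k)"
    using subdiffE[OF v] by blast
  have "(\<lambda>k. q (xs k) + vs k \<bullet> (y - xs k) - W / 2 * (norm (y - xs k))\<^sup>2) \<longlonglongrightarrow>
      q x + v \<bullet> (y - x) - W / 2 * (norm (y - x))\<^sup>2"
    by (intro tendsto_intros lim)
  then show ?thesis
    by (rule LIMSEQ_le_const2) (use frechet_subgradient_weakly_convex[OF wc vs] in blast)
qed

lemma subgradient_convex:
  assumes "convex_on UNIV q" and "v \<in> subdiff q x"
  shows "q x + v \<bullet> (y - x) \<le> q y"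
  using subgradient_weakly_convex[of 0 q v x y] assms by (simp add: weakly_convex_def)

text \<open>For a Frechet subgradient, moving along \<open>v\<close> itself gains about
  \<open>s * (norm v)\<^sup>2\<close> while the Lipschitz bound allows
  \<open>C * s * norm v\<close>; the norm bound then passes to limits.\<close>

lemma subgradient_lipschitz:
  assumes lip: "C-lipschitz_on UNIV q" and v: "v \<in> subdiff q x"
  shows "norm v \<le> C"
proof -
  have C: "0 \<le> C" using lip by (rule lipschitz_on_nonneg)
  have frechet: "norm v \<le> C" if v: "v \<in> frechet_subdiff (\<lambda>u. ereal (q u)) x" for v x
  proof (cases "v = 0")
    case False
    show ?thesis
    proof (rule field_le_epsilon)
      fix e :: real assume e: "0 < e"
      then have "\<forall>\<^sub>F u in at x. q x + v \<bullet> (u - x) - e * norm (u - x) \<le> q u"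
        using v by (simp add: frechet_subdiff_real_iff)
      then have ray: "\<forall>\<^sub>F s in at_right 0. q x + v \<bullet> (x + s *\<^sub>R v - x)
          - e * norm (x + s *\<^sub>R v - x) \<le> q (x + s *\<^sub>R v)"
        using False by (intro eventually_at_ray) auto
      have "\<forall>\<^sub>F s in at_right (0::real). s \<in> {0<..<1}"
        by (rule eventually_at_right_real) simp
      with ray have "\<forall>\<^sub>F s in at_right (0::real). norm v \<le> C + e"
      proof eventually_elim
        case (elim s)
        have "q (x + s *\<^sub>R v) - q x \<le> C * (s * norm v)"
          using lipschitz_onD[OF lip, of "x + s *\<^sub>R v" x] elim by (simp add: dist_norm)
        then have "(s * norm v) * norm v \<le> (s * norm v) * (C + e)"
          using elim by (simp add: algebra_simps dot_square_norm power2_eq_square)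
        then show ?case using elim False by simp
      qed
      then show "norm v \<le> C + e"
        by (simp add: eventually_const_iff)
    qed
  qed (use C in simp)
  obtain xs vs where lim: "vs \<longlonglongrightarrow> v"
    and vs: "\<And>k. vs k \<in> frechet_subdiff (\<lambda>u. ereal (q u)) (xs k)"
    using subdiffE[OF v] by blast
  show ?thesis
    by (rule LIMSEQ_le_const2[OF tendsto_norm[OF lim]]) (use frechet[OF vs] in blast)
qed

text \<open>With \<open>s = sqrt (d u)\<close> and \<open>r = sqrt (d x)\<close>, the claim is \<open>s\<^sup>2 - r\<^sup>2 \<ge> 2 * r * (s - r)\<close>,
  so that no continuity of \<open>d\<close> enters.\<close>

lemma subdiff_of_subdiff_sqrt:
  fixes d :: "'a::euclidean_space \<Rightarrow> real"
  assumes nonneg: "\<forall>x. 0 \<le> d x" and v: "v \<in> subdiff (\<lambda>u. sqrt (d u)) x"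
  shows "(2 * sqrt (d x)) *\<^sub>R v \<in> subdiff d x"
proof -
  have frechet: "(2 * sqrt (d x)) *\<^sub>R v \<in> frechet_subdiff (\<lambda>u. ereal (d u)) x"
    if v: "v \<in> frechet_subdiff (\<lambda>u. ereal (sqrt (d u))) x" for v x
    unfolding frechet_subdiff_real_iff
  proof (intro allI impI)
    fix \<epsilon> :: real assume "\<epsilon> > 0"
    define r where "r = sqrt (d x)"
    have r: "r \<ge> 0" "r\<^sup>2 = d x" using nonneg by (auto simp: r_def)
    \<comment> \<open>The summand 1 keeps the denominator positive when
      \<open>d x = 0\<close>.\<close>
    define \<eta> where "\<eta> = \<epsilon> / (2 * r + 1)"
    have "\<eta> > 0" using \<open>\<epsilon> > 0\<close> r by (simp add: \<eta>_def)
    have "2 * r * \<eta> \<le> \<epsilon>" using \<open>\<epsilon> > 0\<close> r by (simp add: \<eta>_def field_simps)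
    have "\<forall>\<^sub>F u in at x. r + v \<bullet> (u - x) - \<eta> * norm (u - x) \<le> sqrt (d u)"
      using v \<open>\<eta> > 0\<close> by (simp add: frechet_subdiff_real_iff r_def)
    then show "\<forall>\<^sub>F u in at x. d x + ((2 * sqrt (d x)) *\<^sub>R v) \<bullet> (u - x) - \<epsilon> * norm (u - x) \<le> d u"
    proof eventually_elim
      case (elim u)
      have "2 * r * (v \<bullet> (u - x) - \<eta> * norm (u - x)) \<le> 2 * r * (sqrt (d u) - r)"
        using elim r by (intro mult_left_mono) auto
      moreover have "2 * r * (sqrt (d u) - r) \<le> (sqrt (d u))\<^sup>2 - r\<^sup>2"
        using zero_le_power2[of "sqrt (d u) - r"] by (simp add: power2_eq_square algebra_simps)
      moreover have "2 * r * \<eta> * norm (u - x) \<le> \<epsilon> * norm (u - x)"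
        using \<open>2 * r * \<eta> \<le> \<epsilon>\<close> by (intro mult_right_mono) auto
      ultimately show ?case
        using r nonneg by (simp add: r_def[symmetric] algebra_simps)
    qed
  qed
  obtain xs vs where lim: "xs \<longlonglongrightarrow> x" "(\<lambda>k. sqrt (d (xs k))) \<longlonglongrightarrow> sqrt (d x)" "vs \<longlonglongrightarrow> v"
    and vs: "\<And>k. vs k \<in> frechet_subdiff (\<lambda>u. ereal (sqrt (d u))) (xs k)"
    using subdiffE[OF v] by blast
  \<comment> \<open>Squaring recovers the convergence of function values that a limiting subgradient
    of \<open>d\<close> has to come with.\<close>
  have "(\<lambda>k. (sqrt (d (xs k)))\<^sup>2) \<longlonglongrightarrow> (sqrt (d x))\<^sup>2"
    by (intro tendsto_power lim)
  then have "(\<lambda>k. d (xs k)) \<longlonglongrightarrow> d x" using nonneg by simp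
  then have dlim: "(\<lambda>k. ereal (d (xs k))) \<longlonglongrightarrow> ereal (d x)" by (rule tendsto_ereal)
  have vlim: "(\<lambda>k. (2 * sqrt (d (xs k))) *\<^sub>R vs k) \<longlonglongrightarrow> (2 * sqrt (d x)) *\<^sub>R v"
    by (intro tendsto_scaleR tendsto_mult tendsto_const lim)
  show ?thesis
    by (rule limiting_subdiffI[OF _ lim(1) dlim frechet[OF vs] vlim]) simp
qed

section \<open>Gradients and the descent lemma\<close>

lemma GDERIV_unique:
  assumes "GDERIV \<phi> x :> D" "GDERIV \<phi> x :> E"
  shows "D = E"
proof -
  have "(\<lambda>h. h \<bullet> D) = (\<lambda>h. h \<bullet> E)"
    by (rule has_derivative_unique[OF assms[unfolded gderiv_def]])
  then have "\<forall>h. h \<bullet> D = h \<bullet> E" by (simp add: fun_eq_iff)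
  then show ?thesis by (simp add: vector_eq_ldot)
qed

lemma gradient_eqI:
  assumes "GDERIV \<phi> x :> D"
  shows "gradient \<phi> x = D"
  unfolding gradient_def using assms by (rule the_equality) (rule GDERIV_unique[OF _ assms])

lemma differentiable_GDERIV_gradient:
  fixes \<phi> :: "'a::euclidean_space \<Rightarrow> real"
  assumes "\<phi> differentiable (at x)"
  shows "GDERIV \<phi> x :> gradient \<phi> x"
proof -
  obtain D where D: "(\<phi> has_derivative D) (at x)"
    using assms by (auto simp: differentiable_def)
  \<comment> \<open>\<open>adjoint D 1\<close> is the Riesz vector of the linear functional
    \<open>D\<close>.\<close>
  then have "D = (\<lambda>k. k \<bullet> adjoint D 1)"
    using adjoint_works[OF has_derivative_linear[OF D], of _ 1] by simp
  then have g: "GDERIV \<phi> x :> adjoint D 1"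
    using D unfolding gderiv_def by metis
  show ?thesis unfolding gradient_eqI[OF g] by (rule g)
qed

text \<open>The descent lemma. Along the segment, \<open>f\<close> minus its quadratic model has
  nonpositive derivative, because the gradient has moved by at most \<open>L * s * norm e\<close> at
  parameter \<open>s\<close>.\<close>

lemma lipschitz_gradient_upper_bound:
  fixes f :: "'a::euclidean_space \<Rightarrow> real"
  assumes diff: "\<forall>x. f differentiable (at x)" and lip: "L-lipschitz_on UNIV (gradient f)"
  shows "f y \<le> f x + (y - x) \<bullet> gradient f x + L / 2 * (norm (y - x))\<^sup>2"
proof -
  define e where "e = y - x"
  define \<psi> where "\<psi> s = f (x + s *\<^sub>R e) - s * (e \<bullet> gradient f x) - L / 2 * (s\<^sup>2 * (norm e)\<^sup>2)" for s
  have "\<psi> 1 \<le> \<psi> 0"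
  proof (rule DERIV_nonpos_imp_nonincreasing[of 0 1])
    fix s :: real assume s: "0 \<le> s" "s \<le> 1"
    have fd: "(f has_derivative (\<lambda>k. k \<bullet> gradient f (x + s *\<^sub>R e))) (at (x + s *\<^sub>R e))"
      using differentiable_GDERIV_gradient diff unfolding gderiv_def by blast
    have "((\<lambda>s. x + s *\<^sub>R e) has_derivative (\<lambda>k. k *\<^sub>R e)) (at s)"
      by (auto intro!: derivative_eq_intros)
    from has_derivative_compose[OF this fd]
    have "((\<lambda>s. f (x + s *\<^sub>R e)) has_derivative (\<lambda>k. k *\<^sub>R e \<bullet> gradient f (x + s *\<^sub>R e))) (at s)" .
    then have d1: "((\<lambda>s. f (x + s *\<^sub>R e)) has_real_derivative e \<bullet> gradient f (x + s *\<^sub>R e)) (at s)"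
      by (simp add: has_field_derivative_def inner_scaleR_left mult_commute_abs)
    have "((\<lambda>s. s * (e \<bullet> gradient f x) + L / 2 * (s\<^sup>2 * (norm e)\<^sup>2))
        has_real_derivative e \<bullet> gradient f x + L * s * (norm e)\<^sup>2) (at s)"
      by (auto intro!: derivative_eq_intros)
    from DERIV_diff[OF d1 this] have "(\<psi> has_real_derivative
        e \<bullet> gradient f (x + s *\<^sub>R e) - (e \<bullet> gradient f x + L * s * (norm e)\<^sup>2)) (at s)"
      by (simp add: \<psi>_def[abs_def] diff_diff_eq)
    moreover have "e \<bullet> gradient f (x + s *\<^sub>R e) - e \<bullet> gradient f x \<le> L * s * (norm e)\<^sup>2"
    proof -
      have "e \<bullet> gradient f (x + s *\<^sub>R e) - e \<bullet> gradient f x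
          \<le> norm e * norm (gradient f (x + s *\<^sub>R e) - gradient f x)"
        by (metis inner_diff_right norm_cauchy_schwarz)
      also have "\<dots> \<le> norm e * (L * (s * norm e))"
        using lipschitz_onD[OF lip, of "x + s *\<^sub>R e" x] s
        by (intro mult_left_mono) (auto simp: dist_norm)
      finally show ?thesis by (simp add: power2_eq_square algebra_simps)
    qed
    ultimately show "\<exists>D. DERIV \<psi> s :> D \<and> D \<le> 0"
      by force
  qed simp
  then show ?thesis by (simp add: \<psi>_def e_def)
qed

lemma norm_transpose_le: "norm (transpose A *v w) \<le> onorm (\<lambda>v. A *v v) * norm w"
  for A :: "real^'n^'m"
proof -
  let ?u = "transpose A *v w"
  have "(norm ?u)\<^sup>2 = ?u \<bullet> ?u" by (rule power2_norm_eq_inner)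
  also have "\<dots> = w \<bullet> (A *v ?u)" by (simp add: dot_lmul_matrix)
  also have "\<dots> \<le> norm w * norm (A *v ?u)" by (rule norm_cauchy_schwarz)
  also have "\<dots> \<le> norm w * (onorm (\<lambda>v. A *v v) * norm ?u)"
    by (intro mult_left_mono onorm matrix_vector_mul_bounded_linear) auto
  finally have "norm ?u * norm ?u \<le> norm ?u * (onorm (\<lambda>v. A *v v) * norm w)"
    by (simp add: power2_eq_square algebra_simps)
  moreover have "0 \<le> onorm (\<lambda>v. A *v v)"
    by (intro onorm_pos_le matrix_vector_mul_bounded_linear)
  ultimately show ?thesis
    using mult_le_cancel_left_pos[of "norm ?u" "norm ?u"] by (cases "?u = 0") simp_all
qed


section \<open>The Moreau envelope\<close>

text \<open>The classical subgradient of convex analysis. Multipliers are found and used in this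
  global form; the limiting subdifferential of \<open>h\<close> enters only through
  \<open>convex_subgradient_imp_subdiff\<close>, for the criticality measure.\<close>

definition convex_subgradient :: "('a::real_inner \<Rightarrow> real) \<Rightarrow> 'a \<Rightarrow> 'a \<Rightarrow> bool" where
  "convex_subgradient h w v \<longleftrightarrow> (\<forall>u. h w + v \<bullet> (u - w) \<le> h u)"

lemma convex_subgradientD: "convex_subgradient h w v \<Longrightarrow> h w + v \<bullet> (u - w) \<le> h u"
  by (simp add: convex_subgradient_def)

lemma convex_subgradient_monotone:
  assumes "convex_subgradient h w1 v1" "convex_subgradient h w2 v2"
  shows "0 \<le> (v1 - v2) \<bullet> (w1 - w2)"
  using convex_subgradientD[OF assms(1), of w2] convex_subgradientD[OF assms(2), of w1]
  by (simp add: inner_diff_left inner_diff_right)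

lemma convex_subgradient_norm_le:
  assumes lip: "C-lipschitz_on UNIV h" and v: "convex_subgradient h w v"
  shows "norm v \<le> C"
proof (cases "v = 0")
  case True
  then show ?thesis using lipschitz_on_nonneg[OF lip] by simp
next
  case False
  have "norm v * norm v = v \<bullet> (w + v - w)" by (simp add: dot_square_norm power2_eq_square)
  also have "\<dots> \<le> h (w + v) - h w" using convex_subgradientD[OF v, of "w + v"] by simp
  also have "\<dots> \<le> C * norm v" using lipschitz_onD[OF lip, of "w + v" w] by (simp add: dist_norm)
  finally show ?thesis using False by simp
qed

lemma convex_subgradient_imp_subdiff:
  assumes "convex_subgradient h w v"
  shows "v \<in> subdiff h w"
proof -
  have "v \<in> frechet_subdiff (\<lambda>u. ereal (h u)) w"
    by (rule quadratic_minorant_frechet[where c = 0]) (simp_all add: convex_subgradientD[OF assms])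
  then show ?thesis using frechet_subset_limiting by blast
qed

text \<open>Fermat's rule for the proximal step: minimality is tested at
  \<open>w + s *\<^sub>R (u - w)\<close> and divided by \<open>s\<close>; the second-order remainder
  disappears as \<open>s\<close> tends to 0.\<close>

lemma Prox_convex_subgradient:
  assumes h: "convex_on UNIV h" and \<mu>: "\<mu> > 0" and w: "w \<in> Prox b h \<mu>"
  shows "convex_subgradient h w ((1 / \<mu>) *\<^sub>R (b - w))"
  unfolding convex_subgradient_def
proof
  fix u
  have min: "h w + 1 / (2 * \<mu>) * (norm (w - b))\<^sup>2 \<le> h u + 1 / (2 * \<mu>) * (norm (u - b))\<^sup>2" for u
    using w by (auto simp: Prox_def argmin_set_def is_arg_min_linorder)
  have "\<forall>\<^sub>F s in at_right (0::real). s \<in> {0<..<1}"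
    by (rule eventually_at_right_real) simp
  then have "\<forall>\<^sub>F s in at_right (0::real).
      h w + ((1 / \<mu>) *\<^sub>R (b - w)) \<bullet> (u - w) - s * ((norm (u - w))\<^sup>2 / (2 * \<mu>)) \<le> h u"
  proof eventually_elim
    case (elim s)
    have "(1 - s) *\<^sub>R w + s *\<^sub>R u = w + s *\<^sub>R (u - w)" by (simp add: algebra_simps)
    then have "h (w + s *\<^sub>R (u - w)) \<le> (1 - s) * h w + s * h u"
      using convex_onD[OF h, of s w u] elim by simp
    moreover have sq: "(norm (w + s *\<^sub>R (u - w) - b))\<^sup>2
        = (norm (w - b))\<^sup>2 - 2 * s * ((b - w) \<bullet> (u - w)) + s\<^sup>2 * (norm (u - w))\<^sup>2"
      unfolding power2_norm_eq_inner by (simp add: algebra_simps inner_commute power2_eq_square)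
    moreover have "1 / (2 * \<mu>) * (norm (w + s *\<^sub>R (u - w) - b))\<^sup>2 = 1 / (2 * \<mu>) * (norm (w - b))\<^sup>2
        - s * (1 / \<mu> * ((b - w) \<bullet> (u - w))) + s * (s * ((norm (u - w))\<^sup>2 / (2 * \<mu>)))"
      using \<mu> unfolding sq by (simp add: field_simps power2_eq_square)
    ultimately have "s * h w + s * (1 / \<mu> * ((b - w) \<bullet> (u - w))) - s * (s * ((norm (u - w))\<^sup>2 / (2 * \<mu>)))
        \<le> s * h u"
      using min[of "w + s *\<^sub>R (u - w)"] by (simp add: left_diff_distrib)
    then have "s * (h w + ((1 / \<mu>) *\<^sub>R (b - w)) \<bullet> (u - w) - s * ((norm (u - w))\<^sup>2 / (2 * \<mu>))) \<le> s * h u"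
      by (simp add: right_diff_distrib distrib_left)
    then show ?case using elim by simp
  qed
  then have "h w + ((1 / \<mu>) *\<^sub>R (b - w)) \<bullet> (u - w) - 0 * ((norm (u - w))\<^sup>2 / (2 * \<mu>)) \<le> h u"
  proof (rule tendsto_upperbound[rotated])
    show "((\<lambda>s. h w + ((1 / \<mu>) *\<^sub>R (b - w)) \<bullet> (u - w) - s * ((norm (u - w))\<^sup>2 / (2 * \<mu>))) \<longlongrightarrow>
      h w + ((1 / \<mu>) *\<^sub>R (b - w)) \<bullet> (u - w) - 0 * ((norm (u - w))\<^sup>2 / (2 * \<mu>))) (at_right 0)"
      by (intro tendsto_diff tendsto_mult tendsto_const tendsto_ident_at)
  qed simp
  then show "h w + ((1 / \<mu>) *\<^sub>R (b - w)) \<bullet> (u - w) \<le> h u" by simp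
qed

text \<open>Beyond radius \<open>2 * \<mu> * C\<close> the quadratic outweighs the largest drop
  \<open>C * r\<close> that the Lipschitz bound permits, so a minimiser over the compact ball is
  global.\<close>

lemma Prox_nonempty:
  fixes h :: "'a::euclidean_space \<Rightarrow> real"
  assumes lip: "C-lipschitz_on UNIV h" and \<mu>: "\<mu> > 0"
  obtains w where "w \<in> Prox b h \<mu>"
proof -
  define \<psi> where "\<psi> y = h y + 1 / (2 * \<mu>) * (norm (y - b))\<^sup>2" for y
  have C: "0 \<le> C" by (rule lipschitz_on_nonneg[OF lip])
  have "continuous_on (cball b (2 * \<mu> * C)) h"
    using lipschitz_on_continuous_on[OF lip] by (rule continuous_on_subset) simp
  then have cont: "continuous_on (cball b (2 * \<mu> * C)) \<psi>"
    unfolding \<psi>_def by (intro continuous_intros)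
  have "0 \<le> 2 * \<mu> * C" using \<mu> C by simp
  then have "cball b (2 * \<mu> * C) \<noteq> {}" by (simp only: cball_eq_empty not_less)
  then obtain w where w: "w \<in> cball b (2 * \<mu> * C)" "\<forall>y\<in>cball b (2 * \<mu> * C). \<psi> w \<le> \<psi> y"
    using continuous_attains_inf[OF compact_cball _ cont] by blast
  have "\<psi> w \<le> \<psi> y" for y
  proof (cases "y \<in> cball b (2 * \<mu> * C)")
    case False
    define r where "r = norm (y - b)"
    have r: "2 * \<mu> * C < r" using False by (simp add: r_def dist_norm norm_minus_commute)
    have "h b - C * r \<le> h y"
      using lipschitz_onD[OF lip, of y b] by (simp add: dist_norm r_def)
    moreover have "C * r \<le> 1 / (2 * \<mu>) * r\<^sup>2"
      using r \<mu> C mult_right_mono[of "2 * \<mu> * C" r r] by (simp add: field_simps power2_eq_square r_def)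
    moreover have "\<psi> w \<le> \<psi> b" using w(2) \<mu> C by simp
    ultimately show ?thesis by (simp add: \<psi>_def r_def)
  qed (use w in blast)
  then have "w \<in> Prox b h \<mu>"
    by (simp add: Prox_def argmin_set_def is_arg_min_linorder \<psi>_def)
  then show ?thesis by (rule that)
qed

text \<open>Moreau decomposition: \<open>w\<close> is the proximal point of \<open>y\<close>, and
  \<open>v\<close> is the gradient of the envelope at \<open>y\<close>. The envelope estimates below
  write their points in this form, in which \<open>smoothed_at_decomposition\<close> replaces the
  supremum by a closed expression.\<close>

lemma convex_subgradient_decomposition:
  fixes h :: "'a::euclidean_space \<Rightarrow> real"
  assumes "convex_on UNIV h" "C-lipschitz_on UNIV h" "\<mu> > 0"
  obtains w v where "convex_subgradient h w v" "y = w + \<mu> *\<^sub>R v"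
proof -
  obtain w where "w \<in> Prox y h \<mu>" using Prox_nonempty assms by blast
  then have "convex_subgradient h w ((1 / \<mu>) *\<^sub>R (y - w))"
    using Prox_convex_subgradient assms by blast
  moreover have "y = w + \<mu> *\<^sub>R ((1 / \<mu>) *\<^sub>R (y - w))" using assms(3) by simp
  ultimately show ?thesis by (rule that)
qed

text \<open>The equality case of Fenchel-Young.\<close>

lemma conjugate_at_subgradient:
  assumes "convex_subgradient h w v"
  shows "convex_conjugate h v = ereal (w \<bullet> v - h w)"
  unfolding convex_conjugate_def
proof (rule antisym)
  show "(SUP y. ereal (y \<bullet> v - h y)) \<le> ereal (w \<bullet> v - h w)"
    using convex_subgradientD[OF assms]
    by (intro SUP_least) (simp add: inner_diff_right inner_commute algebra_simps)
qed (rule SUP_upper, simp)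

lemma Fenchel_Young: "ereal (w \<bullet> v - h w) \<le> convex_conjugate h v"
  unfolding convex_conjugate_def by (rule SUP_upper) simp

text \<open>The supremum is attained at \<open>u = v\<close>: by Fenchel-Young, any other
  \<open>u\<close> falls short by at least
  \<open>\<mu> / 2 * (norm (v - u))\<^sup>2\<close>.\<close>

lemma smoothed_at_decomposition:
  assumes v: "convex_subgradient h w v" and \<mu>: "\<mu> > 0"
  shows "smoothed h \<mu> (w + \<mu> *\<^sub>R v) = ereal (h w + \<mu> / 2 * (norm v)\<^sup>2)"
  unfolding smoothed_def
proof (rule antisym)
  show "(SUP u. ereal ((w + \<mu> *\<^sub>R v) \<bullet> u) - convex_conjugate h u - ereal (\<mu> / 2 * (norm u)\<^sup>2))
      \<le> ereal (h w + \<mu> / 2 * (norm v)\<^sup>2)"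
  proof (rule SUP_least)
    fix u
    have "0 \<le> \<mu> / 2 * (norm (v - u))\<^sup>2" using \<mu> by simp
    also have "\<dots> = \<mu> / 2 * (norm v)\<^sup>2 - \<mu> * (v \<bullet> u) + \<mu> / 2 * (norm u)\<^sup>2"
      unfolding power2_norm_eq_inner by (simp add: algebra_simps inner_commute)
    finally have "(w + \<mu> *\<^sub>R v) \<bullet> u - (w \<bullet> u - h w) - \<mu> / 2 * (norm u)\<^sup>2 \<le> h w + \<mu> / 2 * (norm v)\<^sup>2"
      by (simp add: inner_add_left)
    then show "ereal ((w + \<mu> *\<^sub>R v) \<bullet> u) - convex_conjugate h u - ereal (\<mu> / 2 * (norm u)\<^sup>2)
      \<le> ereal (h w + \<mu> / 2 * (norm v)\<^sup>2)"
      using Fenchel_Young[of w u h] by (cases "convex_conjugate h u") auto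
  qed
  have "ereal ((w + \<mu> *\<^sub>R v) \<bullet> v) - convex_conjugate h v - ereal (\<mu> / 2 * (norm v)\<^sup>2)
      = ereal (h w + \<mu> / 2 * (norm v)\<^sup>2)"
    by (simp add: conjugate_at_subgradient[OF v] inner_add_left dot_square_norm)
  then show "ereal (h w + \<mu> / 2 * (norm v)\<^sup>2) \<le>
      (SUP u. ereal ((w + \<mu> *\<^sub>R v) \<bullet> u) - convex_conjugate h u - ereal (\<mu> / 2 * (norm u)\<^sup>2))"
    by (intro SUP_upper2[of v]) simp_all
qed

abbreviation envelope :: "('a::real_inner \<Rightarrow> real) \<Rightarrow> real \<Rightarrow> 'a \<Rightarrow> real" where
  "envelope h \<mu> y \<equiv> real_of_ereal (smoothed h \<mu> y)"

context
  fixes h :: "'a::euclidean_space \<Rightarrow> real" and C :: real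
  assumes h_convex: "convex_on UNIV h" and h_lip: "C-lipschitz_on UNIV h"
begin

lemma smoothed_eq_envelope:
  assumes "\<mu> > 0"
  shows "smoothed h \<mu> y = ereal (envelope h \<mu> y)"
proof -
  obtain w v where "convex_subgradient h w v" "y = w + \<mu> *\<^sub>R v"
    using convex_subgradient_decomposition[OF h_convex h_lip assms] .
  then show ?thesis using smoothed_at_decomposition assms by force
qed

lemma envelope_le:
  assumes "\<mu> > 0"
  shows "envelope h \<mu> y \<le> h y"
proof -
  obtain w v where v: "convex_subgradient h w v" and y: "y = w + \<mu> *\<^sub>R v"
    using convex_subgradient_decomposition[OF h_convex h_lip assms] .
  have "\<mu> / 2 * (norm v)\<^sup>2 \<le> \<mu> * (norm v)\<^sup>2" using assms by simp
  then show ?thesis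
    using convex_subgradientD[OF v, of y] smoothed_at_decomposition[OF v assms]
    by (simp add: y dot_square_norm)
qed

text \<open>The Lipschitz bound loses \<open>C * (\<mu> * norm v)\<close>. Young's inequality splits
  this so that the part in \<open>norm v\<close> is repaid by the term
  \<open>\<mu> / 2 * (norm v)\<^sup>2\<close> of the envelope.\<close>

lemma envelope_ge:
  assumes "\<mu> > 0"
  shows "h y - \<mu> / 2 * C\<^sup>2 \<le> envelope h \<mu> y"
proof -
  obtain w v where v: "convex_subgradient h w v" and y: "y = w + \<mu> *\<^sub>R v"
    using convex_subgradient_decomposition[OF h_convex h_lip assms] .
  have "h y - C * (\<mu> * norm v) \<le> h w"
    using lipschitz_onD[OF h_lip, of y w] assms by (simp add: dist_norm y)
  moreover have "0 \<le> \<mu> / 2 * (C - norm v)\<^sup>2" using assms by simp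
  then have "C * (\<mu> * norm v) \<le> \<mu> / 2 * C\<^sup>2 + \<mu> / 2 * (norm v)\<^sup>2"
    by (simp add: power2_eq_square algebra_simps)
  ultimately show ?thesis
    using smoothed_at_decomposition[OF v assms] by (simp add: y)
qed

text \<open>Both points are decomposed; the subgradient inequality of \<open>h\<close> between the
  proximal points and a square in \<open>v' - v\<close> add up to the claim.\<close>

lemma envelope_gradient_inequality:
  assumes \<mu>: "\<mu> > 0" and v: "convex_subgradient h w v"
  shows "envelope h \<mu> (w + \<mu> *\<^sub>R v) + v \<bullet> (y - (w + \<mu> *\<^sub>R v)) \<le> envelope h \<mu> y"
proof -
  obtain w' v' where v': "convex_subgradient h w' v'" and y: "y = w' + \<mu> *\<^sub>R v'"
    using convex_subgradient_decomposition[OF h_convex h_lip \<mu>] .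
  have "0 \<le> \<mu> / 2 * (norm (v' - v))\<^sup>2" using \<mu> by simp
  also have "\<dots> = \<mu> / 2 * (norm v')\<^sup>2 - \<mu> * (v \<bullet> v') + \<mu> / 2 * (norm v)\<^sup>2"
    unfolding power2_norm_eq_inner by (simp add: algebra_simps inner_commute)
  finally have "h w + \<mu> / 2 * (norm v)\<^sup>2 + v \<bullet> (y - (w + \<mu> *\<^sub>R v)) \<le>
      h w + v \<bullet> (w' - w) + \<mu> / 2 * (norm v')\<^sup>2"
    by (simp add: y algebra_simps dot_square_norm)
  also have "\<dots> \<le> h w' + \<mu> / 2 * (norm v')\<^sup>2"
    using convex_subgradientD[OF v] by simp
  finally show ?thesis
    using smoothed_at_decomposition[OF v \<mu>] smoothed_at_decomposition[OF v' \<mu>] by (simp add: y)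
qed

text \<open>One point \<open>y\<close> is decomposed for both parameters, and the subgradient
  inequality at \<open>w\<close> is combined with a square in \<open>v' - v\<close>. The cost is
  linear in the change of the parameter, hence telescopes along a run.\<close>

lemma envelope_parameter_decrease:
  assumes \<mu>: "0 < \<mu>'" "\<mu>' \<le> \<mu>"
  shows "envelope h \<mu>' y \<le> envelope h \<mu> y + (\<mu> - \<mu>') / 2 * C\<^sup>2"
proof -
  obtain w v where v: "convex_subgradient h w v" and y: "y = w + \<mu>' *\<^sub>R v"
    using convex_subgradient_decomposition[OF h_convex h_lip \<mu>(1)] .
  obtain w' v' where v': "convex_subgradient h w' v'" and y': "y = w' + \<mu> *\<^sub>R v'"
    using convex_subgradient_decomposition[OF h_convex h_lip, of \<mu>] \<mu> by auto
  have "w' - w = \<mu>' *\<^sub>R v - \<mu> *\<^sub>R v'" using y y' by (simp add: algebra_simps)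
  then have "h w + v \<bullet> (\<mu>' *\<^sub>R v - \<mu> *\<^sub>R v') \<le> h w'"
    using convex_subgradientD[OF v, of w'] by simp
  moreover have "0 \<le> \<mu> / 2 * (norm (v' - v))\<^sup>2" using \<mu> by simp
  moreover have "\<mu> / 2 * (norm (v' - v))\<^sup>2 = \<mu> / 2 * (norm v')\<^sup>2 - \<mu> * (v \<bullet> v') + \<mu> / 2 * (norm v)\<^sup>2"
    unfolding power2_norm_eq_inner by (simp add: algebra_simps inner_commute)
  ultimately have "h w + \<mu>' / 2 * (norm v)\<^sup>2 \<le> h w' + \<mu> / 2 * (norm v')\<^sup>2 + (\<mu> - \<mu>') / 2 * (norm v)\<^sup>2"
    by (simp add: algebra_simps dot_square_norm diff_divide_distrib)
  moreover have "(\<mu> - \<mu>') / 2 * (norm v)\<^sup>2 \<le> (\<mu> - \<mu>') / 2 * C\<^sup>2"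
    using convex_subgradient_norm_le[OF h_lip v] \<mu> by (intro mult_left_mono power_mono) auto
  moreover have "envelope h \<mu>' y = h w + \<mu>' / 2 * (norm v)\<^sup>2"
    using smoothed_at_decomposition[OF v \<mu>(1)] by (simp add: y)
  moreover have "envelope h \<mu> y = h w' + \<mu> / 2 * (norm v')\<^sup>2"
    using smoothed_at_decomposition[OF v', of \<mu>] \<mu> by (simp add: y')
  ultimately show ?thesis by linarith
qed

text \<open>The minimiser is \<open>w + \<mu> v\<close>, since there the gradient \<open>v\<close> of the envelope cancels
  \<open>\<beta> (w + \<mu> v - b)\<close>.\<close>

lemma envelope_penalised_growth:
  assumes "\<mu> > 0" "\<beta> > 0" and v: "convex_subgradient h w v" and b: "b = w + (\<mu> + 1 / \<beta>) *\<^sub>R v"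
  shows "envelope h \<mu> (w + \<mu> *\<^sub>R v) + \<beta> / 2 * (norm (w + \<mu> *\<^sub>R v - b))\<^sup>2
      + \<beta> / 2 * (norm (y - (w + \<mu> *\<^sub>R v)))\<^sup>2
    \<le> envelope h \<mu> y + \<beta> / 2 * (norm (y - b))\<^sup>2"
proof -
  define k where "k = w + \<mu> *\<^sub>R v"
  have b: "b = k + (1 / \<beta>) *\<^sub>R v" by (simp add: b k_def scaleR_add_left)
  have "(norm (y - b))\<^sup>2 = (norm (y - k))\<^sup>2 - 2 * (1 / \<beta>) * (v \<bullet> (y - k)) + (norm (k - b))\<^sup>2"
    unfolding power2_norm_eq_inner b by (simp add: algebra_simps inner_commute)
  then have "\<beta> / 2 * (norm (y - b))\<^sup>2
      = \<beta> / 2 * (norm (y - k))\<^sup>2 - v \<bullet> (y - k) + \<beta> / 2 * (norm (k - b))\<^sup>2"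
    using \<open>\<beta> > 0\<close> by (simp add: field_simps)
  then show ?thesis
    using envelope_gradient_inequality[OF \<open>\<mu> > 0\<close> v, of y] unfolding k_def[symmetric] by linarith
qed

text \<open>Quadratic growth excludes every other minimiser. This ties the \<open>y\<close>-update
  to the proximal point and so identifies the new multiplier as a subgradient.\<close>

lemma argmin_envelope_penalised:
  assumes "\<mu> > 0" "\<beta> > 0" and v: "convex_subgradient h w v" and b: "b = w + (\<mu> + 1 / \<beta>) *\<^sub>R v"
    and y: "y \<in> argmin_set (\<lambda>v. smoothed h \<mu> v + ereal (\<beta> / 2 * (norm (v - b))\<^sup>2))"
  shows "y = w + \<mu> *\<^sub>R v"
proof -
  have "ereal (envelope h \<mu> y) + ereal (\<beta> / 2 * (norm (y - b))\<^sup>2)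
      \<le> ereal (envelope h \<mu> (w + \<mu> *\<^sub>R v)) + ereal (\<beta> / 2 * (norm (w + \<mu> *\<^sub>R v - b))\<^sup>2)"
    using y \<open>\<mu> > 0\<close> unfolding argmin_set_def is_arg_min_linorder
    by (simp add: smoothed_eq_envelope[symmetric])
  then have "\<beta> / 2 * (norm (y - (w + \<mu> *\<^sub>R v)))\<^sup>2 \<le> 0"
    using envelope_penalised_growth[OF assms(1-4), of y] by simp
  then show ?thesis using \<open>\<beta> > 0\<close> by (simp add: mult_le_0_iff)
qed

end


section \<open>Single steps of the algorithm\<close>

text \<open>Re-expanding the quadratic around \<open>x'\<close> turns minimality into a quadratic
  minorant of \<delta> with constant \<open>\<kappa> / 2\<close>, an argument that suits nonconvex
  \<delta>.\<close>

lemma prox_linear_subgradient: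
  fixes \<delta> :: "'a::euclidean_space \<Rightarrow> ereal"
  assumes x': "x' \<in> argmin_set (\<lambda>u. \<delta> u + ereal ((u - x) \<bullet> G + \<kappa> / 2 * (norm (u - x))\<^sup>2))"
    and fin: "\<bar>\<delta> x'\<bar> \<noteq> \<infinity>"
  shows "- (G + \<kappa> *\<^sub>R (x' - x)) \<in> limiting_subdiff \<delta> x'"
proof -
  obtain r where r: "\<delta> x' = ereal r" using fin by auto
  have "- (G + \<kappa> *\<^sub>R (x' - x)) \<in> frechet_subdiff \<delta> x'"
  proof (rule quadratic_minorant_frechet[where c = "\<kappa> / 2"])
    show "\<bar>\<delta> x'\<bar> \<noteq> \<infinity>" by (rule fin)
    fix u
    have min: "\<delta> x' + ereal ((x' - x) \<bullet> G + \<kappa> / 2 * (norm (x' - x))\<^sup>2)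
        \<le> \<delta> u + ereal ((u - x) \<bullet> G + \<kappa> / 2 * (norm (u - x))\<^sup>2)"
      using x' by (simp add: argmin_set_def is_arg_min_linorder)
    have sq: "(norm (u - x))\<^sup>2 = (norm (x' - x))\<^sup>2 + 2 * ((x' - x) \<bullet> (u - x')) + (norm (u - x'))\<^sup>2"
      unfolding power2_norm_eq_inner by (simp add: algebra_simps inner_commute)
    have expand: "(u - x) \<bullet> G + \<kappa> / 2 * (norm (u - x))\<^sup>2 - ((x' - x) \<bullet> G + \<kappa> / 2 * (norm (x' - x))\<^sup>2)
        = - (- (G + \<kappa> *\<^sub>R (x' - x)) \<bullet> (u - x') - \<kappa> / 2 * (norm (u - x'))\<^sup>2)"
      unfolding sq by (simp add: algebra_simps inner_commute)
    show "\<delta> x' + ereal (- (G + \<kappa> *\<^sub>R (x' - x)) \<bullet> (u - x') - \<kappa> / 2 * (norm (u - x'))\<^sup>2) \<le> \<delta> u"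
    proof (cases "\<delta> u")
      case (real s)
      then show ?thesis using min expand by (simp add: r)
    next
      case MInf
      then show ?thesis using min by (simp add: r)
    qed simp
  qed
  then show ?thesis using frechet_subset_limiting by blast
qed

lemma gradient_smooth_part:
  fixes A :: "real^'n^'m"
  assumes "f differentiable (at x)"
  shows "gradient (smooth_part f A y z \<beta>) x
    = gradient f x + transpose A *v z + \<beta> *\<^sub>R (transpose A *v (A *v x - y))"
proof (rule gradient_eqI)
  have fd: "(f has_derivative (\<lambda>k. k \<bullet> gradient f x)) (at x)"
    using differentiable_GDERIV_gradient[OF assms] by (simp add: gderiv_def)
  have Ad: "((\<lambda>x. A *v x - y) has_derivative (\<lambda>k. A *v k)) (at x)"
    using has_derivative_diff[OF bounded_linear_imp_has_derivative[OF
        matrix_vector_mul_bounded_linear[of A]] has_derivative_const[of y]] by simp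
  have "((\<lambda>x. (A *v x - y) \<bullet> z) has_derivative (\<lambda>k. (A *v k) \<bullet> z)) (at x)"
    by (rule has_derivative_inner_left[OF Ad])
  moreover have "((\<lambda>x. (A *v x - y) \<bullet> (A *v x - y)) has_derivative
      (\<lambda>k. (A *v x - y) \<bullet> (A *v k) + (A *v k) \<bullet> (A *v x - y))) (at x)"
    by (rule has_derivative_inner[OF Ad Ad])
  ultimately have "(smooth_part f A y z \<beta> has_derivative
      (\<lambda>k. k \<bullet> gradient f x + (A *v k) \<bullet> z
        + \<beta> / 2 * ((A *v x - y) \<bullet> (A *v k) + (A *v k) \<bullet> (A *v x - y)))) (at x)"
    unfolding smooth_part_def[abs_def] power2_norm_eq_inner
    by (intro has_derivative_add has_derivative_mult_right fd)
  moreover have "(\<lambda>k. k \<bullet> gradient f x + (A *v k) \<bullet> z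
        + \<beta> / 2 * ((A *v x - y) \<bullet> (A *v k) + (A *v k) \<bullet> (A *v x - y)))
     = (\<lambda>k. k \<bullet> (gradient f x + transpose A *v z + \<beta> *\<^sub>R (transpose A *v (A *v x - y))))"
  proof
    fix k
    have T: "k \<bullet> (transpose A *v w) = (A *v k) \<bullet> w" for w
      by (metis dot_lmul_matrix inner_commute transpose_matrix_vector)
    show "k \<bullet> gradient f x + (A *v k) \<bullet> z
        + \<beta> / 2 * ((A *v x - y) \<bullet> (A *v k) + (A *v k) \<bullet> (A *v x - y))
     = k \<bullet> (gradient f x + transpose A *v z + \<beta> *\<^sub>R (transpose A *v (A *v x - y)))"
      unfolding inner_add_right inner_scaleR_right T inner_commute[of "A *v x - y"] by simp
  qed
  ultimately show "GDERIV (smooth_part f A y z \<beta>) x :>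
      gradient f x + transpose A *v z + \<beta> *\<^sub>R (transpose A *v (A *v x - y))"
    unfolding gderiv_def by (simp only:)
qed

lemma norm_matrix_vector_le: "norm (A *v w) \<le> onorm (\<lambda>v. A *v v) * norm w"
  for A :: "real^'n^'m"
  by (rule onorm[OF matrix_vector_mul_bounded_linear])

lemma onorm_matrix_nonneg: "0 \<le> onorm (\<lambda>v. A *v v)" for A :: "real^'n^'m"
  by (rule onorm_pos_le[OF matrix_vector_mul_bounded_linear])

text \<open>The quadratic part is expanded exactly and only \<open>norm (A *v k)\<close> is
  estimated; the first two summands of \<open>ell\<close> originate here.\<close>

lemma smooth_part_upper_bound:
  fixes A :: "real^'n^'m"
  assumes diff: "\<forall>x. f differentiable (at x)" and lip: "L-lipschitz_on UNIV (gradient f)"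
    and "0 \<le> \<beta>"
  shows "smooth_part f A y z \<beta> x' \<le> smooth_part f A y z \<beta> x
    + (x' - x) \<bullet> gradient (smooth_part f A y z \<beta>) x
    + (L + \<beta> * (onorm (\<lambda>v. A *v v))\<^sup>2) / 2 * (norm (x' - x))\<^sup>2"
proof -
  define k where "k = x' - x"
  define r where "r = A *v x - y"
  have T: "k \<bullet> (transpose A *v w) = (A *v k) \<bullet> w" for w
    by (metis dot_lmul_matrix inner_commute transpose_matrix_vector)
  have Ax': "A *v x' - y = r + A *v k"
    by (simp add: k_def r_def matrix_vector_mult_diff_distrib)
  have fx': "f x' \<le> f x + k \<bullet> gradient f x + L / 2 * (norm k)\<^sup>2"
    unfolding k_def by (rule lipschitz_gradient_upper_bound[OF diff lip])
  have "(norm (A *v k))\<^sup>2 \<le> (onorm (\<lambda>v. A *v v) * norm k)\<^sup>2"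
    by (intro power_mono norm_matrix_vector_le) simp
  then have Ak: "\<beta> / 2 * (norm (A *v k))\<^sup>2 \<le> \<beta> / 2 * ((onorm (\<lambda>v. A *v v))\<^sup>2 * (norm k)\<^sup>2)"
    using \<open>0 \<le> \<beta>\<close> by (intro mult_left_mono) (simp_all add: power_mult_distrib)
  have "(norm (r + A *v k))\<^sup>2 = (norm r)\<^sup>2 + 2 * ((A *v k) \<bullet> r) + (norm (A *v k))\<^sup>2"
    unfolding power2_norm_eq_inner by (simp add: algebra_simps inner_commute)
  then have sq: "\<beta> / 2 * (norm (r + A *v k))\<^sup>2
      = \<beta> / 2 * (norm r)\<^sup>2 + \<beta> * ((A *v k) \<bullet> r) + \<beta> / 2 * (norm (A *v k))\<^sup>2"
    by (simp add: algebra_simps)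
  have grad: "k \<bullet> gradient (smooth_part f A y z \<beta>) x
      = k \<bullet> gradient f x + (A *v k) \<bullet> z + \<beta> * ((A *v k) \<bullet> r)"
    unfolding gradient_smooth_part[OF diff[rule_format]] inner_add_right inner_scaleR_right T r_def ..
  have "(L + \<beta> * (onorm (\<lambda>v. A *v v))\<^sup>2) / 2 * (norm k)\<^sup>2
      = L / 2 * (norm k)\<^sup>2 + \<beta> / 2 * ((onorm (\<lambda>v. A *v v))\<^sup>2 * (norm k)\<^sup>2)"
    by (simp add: field_simps)
  then show ?thesis
    using fx' Ak sq grad
    unfolding k_def[symmetric] smooth_part_def Ax' r_def[symmetric] inner_add_left by linarith
qed

lemma denom_weight_pos: "0 < U \<Longrightarrow> 0 < dx \<Longrightarrow> 0 < denom_weight var U dx"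
  by (cases var) (simp_all add: denom_weight_def)

text \<open>For FADMM-Q the chain-rule factor \<open>2 * sqrt (d x)\<close> converts the weight
  \<open>2 * U / sqrt (d x)\<close> into \<open>U / d x\<close>. Both variants thus share one
  stationarity condition, in terms of a subgradient of \<open>d\<close>.\<close>

lemma denom_subgradient:
  fixes d :: "'a::euclidean_space \<Rightarrow> real"
  assumes "\<forall>x. 0 \<le> d x" "0 < d x" "0 < U" "\<zeta> \<in> subdiff (denom_part var d) x"
  obtains \<zeta>\<^sub>d where "\<zeta>\<^sub>d \<in> subdiff d x" "denom_weight var U (d x) *\<^sub>R \<zeta> = (U / d x) *\<^sub>R \<zeta>\<^sub>d"
proof (cases var)
  case FADMM_D
  then show ?thesis using that assms by (simp add: denom_weight_def denom_part_def)
next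
  case FADMM_Q
  have "(2 * sqrt (d x)) *\<^sub>R \<zeta> \<in> subdiff d x"
    using assms FADMM_Q by (intro subdiff_of_subdiff_sqrt) (simp_all add: denom_part_def)
  moreover have "denom_weight var U (d x) = U / d x * (2 * sqrt (d x))"
    using FADMM_Q assms by (simp add: denom_weight_def field_simps)
  ultimately show ?thesis using that by simp
qed

text \<open>For FADMM-Q the claim reduces to \<open>2 * s - 1 \<le> s\<^sup>2\<close> with \<open>s = sqrt (d x') / sqrt (d x)\<close>.\<close>

lemma ratio_decrease:
  assumes pos: "0 < d x" "0 < d x'" "0 < U"
    and V: "V - denom_weight var U (d x) * denom_part var d x'
      \<le> U - denom_weight var U (d x) * denom_part var d x - E"
  shows "V / d x' \<le> U / d x - E / d x'"
proof -
  have "denom_weight var U (d x) * denom_part var d x'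
      + U - denom_weight var U (d x) * denom_part var d x \<le> U / d x * d x'"
  proof (cases var)
    case FADMM_D
    then show ?thesis using pos by (simp add: denom_weight_def denom_part_def)
  next
    case FADMM_Q
    define s where "s = sqrt (d x') / sqrt (d x)"
    have "s\<^sup>2 = d x' / d x" using pos by (simp add: s_def power_divide)
    moreover have "0 \<le> U * (s - 1)\<^sup>2" using pos by simp
    ultimately have "U * (2 * s) - U \<le> U / d x * d x'"
      by (simp add: power2_diff algebra_simps)
    moreover have "denom_weight var U (d x) * denom_part var d x' = U * (2 * s)"
      using FADMM_Q by (simp add: denom_weight_def denom_part_def s_def)
    moreover have "denom_weight var U (d x) * denom_part var d x = 2 * U"
      using FADMM_Q pos by (simp add: denom_weight_def denom_part_def)
    ultimately show ?thesis by simp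
  qed
  then have "V \<le> U / d x * d x' - E" using V by linarith
  then show ?thesis using pos by (simp add: field_simps)
qed

lemma penalty_growth:
  assumes "0 < \<beta>\<^sub>0" "0 < \<xi>" "0 < p" "p < 1"
  shows "\<beta>\<^sub>0 \<le> penalty \<beta>\<^sub>0 \<xi> p t"
    and "penalty \<beta>\<^sub>0 \<xi> p t \<le> penalty \<beta>\<^sub>0 \<xi> p (Suc t)"
    and "penalty \<beta>\<^sub>0 \<xi> p (Suc t) \<le> penalty \<beta>\<^sub>0 \<xi> p t + \<xi> * \<beta>\<^sub>0"
    and "penalty \<beta>\<^sub>0 \<xi> p (Suc t) \<le> \<beta>\<^sub>0 * (1 + \<xi>) * real (Suc t) powr p"
    and "\<beta>\<^sub>0 * \<xi> * real t powr p \<le> penalty \<beta>\<^sub>0 \<xi> p t"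
proof -
  show "\<beta>\<^sub>0 \<le> penalty \<beta>\<^sub>0 \<xi> p t" "\<beta>\<^sub>0 * \<xi> * real t powr p \<le> penalty \<beta>\<^sub>0 \<xi> p t"
    using assms by (simp_all add: penalty_def algebra_simps)
  have mono: "real t powr p \<le> real (Suc t) powr p" using assms by (intro powr_mono2) auto
  then show "penalty \<beta>\<^sub>0 \<xi> p t \<le> penalty \<beta>\<^sub>0 \<xi> p (Suc t)"
    using assms by (simp add: penalty_def)
  have "real (Suc t) powr p \<le> real t powr p + 1"
  proof (cases "t = 0")
    case False
    have split: "s powr p = s * s powr (p - 1)" if "s > 0" for s :: real
      using that by (simp add: powr_diff)
    \<comment> \<open>The exponent \<open>p - 1\<close> is negative, so replacing the base
      \<open>Suc t\<close> by \<open>t\<close>, respectively by 1, only increases the power.\<close>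
    have "real (Suc t) powr p = real t * real (Suc t) powr (p - 1) + real (Suc t) powr (p - 1)"
      by (subst split) (simp_all add: algebra_simps)
    also have "\<dots> \<le> real t * real t powr (p - 1) + 1 powr (p - 1)"
      using False assms by (intro add_mono mult_left_mono powr_mono2') auto
    also have "\<dots> = real t powr p + 1" using False by (subst split) auto
    finally show ?thesis .
  qed simp
  from mult_left_mono[OF this, of "\<beta>\<^sub>0 * \<xi>"]
  show "penalty \<beta>\<^sub>0 \<xi> p (Suc t) \<le> penalty \<beta>\<^sub>0 \<xi> p t + \<xi> * \<beta>\<^sub>0"
    using assms by (simp add: penalty_def algebra_simps)
  have "1 \<le> real (Suc t) powr p" using assms by (intro ge_one_powr_ge_zero) auto
  from mult_left_mono[OF this, of "\<beta>\<^sub>0"]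
  show "penalty \<beta>\<^sub>0 \<xi> p (Suc t) \<le> \<beta>\<^sub>0 * (1 + \<xi>) * real (Suc t) powr p"
    using assms by (simp add: penalty_def algebra_simps)
qed

text \<open>Averaging over the last half loses only a factor 2, and every index there satisfies
  \<open>T \<le> 2 * t\<close>, so errors of size \<open>1 / \<beta> t\<close> become of order
  \<open>T powr (- p)\<close>.\<close>

lemma small_term_in_second_half:
  fixes e :: "nat \<Rightarrow> real"
  assumes "1 \<le> T" and sum: "(\<Sum>t=1..T. e t) \<le> K" and nonneg: "\<And>t. 1 \<le> t \<Longrightarrow> 0 \<le> e t"
  obtains t where "1 \<le> t" "t \<le> T" "T \<le> 2 * t" "e t \<le> 2 * K / real T"
proof -
  \<comment> \<open>This interval has \<open>T div 2 + 1\<close> elements, at least half of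
    \<open>T\<close> for either parity.\<close>
  define I where "I = {T - T div 2..T}"
  have I: "I \<subseteq> {1..T}" "finite I" "I \<noteq> {}" using assms(1) by (auto simp: I_def)
  have card: "real T / 2 \<le> real (card I)" by (simp add: I_def)
  have "\<exists>t\<in>I. e t \<le> 2 * K / real T"
  proof (rule ccontr)
    assume "\<not> (\<exists>t\<in>I. e t \<le> 2 * K / real T)"
    then have "(\<Sum>t\<in>I. 2 * K / real T) < (\<Sum>t\<in>I. e t)"
      using I by (intro sum_strict_mono) (auto simp: not_le)
    also have "\<dots> \<le> (\<Sum>t=1..T. e t)"
      using I nonneg by (intro sum_mono2) auto
    also have "\<dots> \<le> K" by (rule sum)
    finally have lt: "real (card I) * (2 * K / real T) < K" by simp
    have "0 \<le> K" using sum_nonneg[of "{1..T}" e] nonneg sum by force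
    then have "real T / 2 * (2 * K / real T) \<le> real (card I) * (2 * K / real T)"
      using card by (intro mult_right_mono) auto
    then show False using lt assms(1) by simp
  qed
  then obtain t where "t \<in> I" "e t \<le> 2 * K / real T" by blast
  then show ?thesis using I(1) by (intro that[of t]) (auto simp: I_def)
qed

lemma norm_five_terms_le:
  fixes a b c e k :: "'a::real_normed_vector"
  shows "norm (a + b - c - e + k) \<le> norm a + norm b + norm c + norm e + norm k"
  using norm_triangle_ineq[of "a + b - c - e" k] norm_triangle_ineq4[of "a + b - c" e]
    norm_triangle_ineq4[of "a + b" c] norm_triangle_ineq[of a b] by linarith

lemma cube_root_rate_le:
  assumes "0 < K" "0 < \<epsilon>" "1 \<le> T" "K ^ 3 / \<epsilon> ^ 3 \<le> real T"
  shows "K * real T powr (- 1 / 3) \<le> \<epsilon>"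
proof -
  have "K / \<epsilon> = ((K / \<epsilon>) powr 3) powr (1 / 3)"
    unfolding powr_powr using assms by simp
  also have "(K / \<epsilon>) powr 3 = (K / \<epsilon>) ^ 3"
    using assms by (intro powr_numeral) simp
  also have "((K / \<epsilon>) ^ 3) powr (1 / 3) \<le> real T powr (1 / 3)"
    using assms by (intro powr_mono2) (simp_all add: power_divide)
  finally have "K / real T powr (1 / 3) \<le> \<epsilon>" using assms by (simp add: field_simps)
  moreover have "real T powr (- 1 / 3) = 1 / real T powr (1 / 3)"
    by (simp add: powr_minus_divide)
  ultimately show ?thesis by simp
qed


section \<open>Convergence\<close>

text \<open>Holds only data fixed before a run, so every constant defined in it is independent of
  the iterates and of \<open>T\<close>.\<close>

locale fadmm_setting =
  fixes f g d :: "real^'n \<Rightarrow> real" and \<delta> :: "real^'n \<Rightarrow> ereal" and h :: "real^'m \<Rightarrow> real"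
    and A :: "real^'n^'m"
    and L\<^sub>f C\<^sub>h C\<^sub>d W\<^sub>d \<xi> \<theta> p chi \<beta>\<^sub>0 d_lo d_hi F_lo F_hi :: real
    and var :: fadmm_variant and z0 :: "real^'m"
  assumes f_diff: "\<forall>x. f differentiable (at x)"
    and f_grad: "L\<^sub>f-lipschitz_on UNIV (gradient f)"
    and \<delta>_proper: "proper_fun \<delta>"
    and g_convex: "convex_on UNIV g"
    and h_convex: "convex_on UNIV h" and h_lip: "C\<^sub>h-lipschitz_on UNIV h"
    and d_nonneg: "\<forall>x. 0 \<le> d x" and d_lip: "C\<^sub>d-lipschitz_on UNIV d"
    and W_nonneg: "0 \<le> W\<^sub>d"
    and q_weakly_convex: "weakly_convex W\<^sub>d (denom_part var d)"
    and nondegenerate: "A \<noteq> 0 \<or> 0 < L\<^sub>f \<or> 0 < W\<^sub>d"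
    and \<xi>_pos: "0 < \<xi>" and \<theta>_gt_1: "1 < \<theta>" and p_pos: "0 < p" and p_lt_1: "p < 1"
    and chi_large: "2 * sqrt (1 + \<xi>) < chi" and \<beta>\<^sub>0_pos: "0 < \<beta>\<^sub>0"
    and d_bounds: "0 < d_lo" "d_lo \<le> d_hi" and F_bounds: "0 < F_lo" "F_lo \<le> F_hi"
    and \<beta>\<^sub>0_large: "\<beta>\<^sub>0 > (8 * (max (norm z0) C\<^sub>h)\<^sup>2 + 1 / 2 * chi * (max (norm z0) C\<^sub>h)\<^sup>2) / (F_lo * d_lo)"
begin

abbreviation \<beta> :: "nat \<Rightarrow> real" where "\<beta> \<equiv> penalty \<beta>\<^sub>0 \<xi> p"
abbreviation \<mu> :: "nat \<Rightarrow> real" where "\<mu> t \<equiv> chi / \<beta> t"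
abbreviation A_norm :: real where "A_norm \<equiv> onorm (\<lambda>v. A *v v)"

section \<open>Constants in terms of the problem data\<close>

definition z_bd :: real where "z_bd = max (norm z0) C\<^sub>h"
text \<open>In \<open>U_lo\<close>, \<open>2 * z_bd\<^sup>2\<close> pays for the multiplier term and
  for exchanging \<open>h (A *v x)\<close> with \<open>h y\<close>, and
  \<open>chi / 2 * z_bd\<^sup>2\<close> for the smoothing. In \<open>U_hi\<close>, the factor
  \<open>3 + \<xi>\<close> is 2 for the same two terms plus \<open>1 + \<xi>\<close> for the
  penalty.\<close>

definition U_lo :: real where "U_lo = F_lo * d_lo - (2 + chi / 2) * z_bd\<^sup>2 / \<beta>\<^sub>0"
definition U_hi :: real where "U_hi = F_hi * d_hi + (3 + \<xi>) * (2 * z_bd\<^sup>2 / \<beta>\<^sub>0)"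
definition w_lo :: real where "w_lo = min (U_lo / d_hi) (2 * U_lo / sqrt d_hi)"
definition w_hi :: real where "w_hi = max (U_hi / d_lo) (2 * U_hi / sqrt d_lo)"
definition ell_lo :: real where "ell_lo = L\<^sub>f + \<beta>\<^sub>0 * A_norm\<^sup>2 + w_lo * W\<^sub>d"
definition ell_hi :: real where "ell_hi = L\<^sub>f + \<beta>\<^sub>0 * (1 + \<xi>) * A_norm\<^sup>2 + w_hi * W\<^sub>d"
definition gap :: real where "gap = (2 + \<xi>) * (1 + \<xi>) * 2 * z_bd\<^sup>2 + chi / 2 * z_bd\<^sup>2"
text \<open>The gain 1 / 2 of the \<open>y\<close>-step less the share consumed by the multiplier
  step; \<kappa> below adds the two drift coefficients, from the multiplier and from the decrease of
  the smoothing parameter.\<close>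

definition c_y :: real where "c_y = 1 / 2 - (2 + \<xi>) / chi\<^sup>2"
definition \<kappa> :: real where "\<kappa> = (2 + \<xi>) * \<xi> * z_bd\<^sup>2 + chi / 2 * z_bd\<^sup>2"
definition total :: real where "total = U_hi / d_lo + 2 * (\<kappa> / d_lo) / \<beta>\<^sub>0"
definition k_x :: real where "k_x = 1 / ell_lo + 1 + \<theta>"
definition k_y :: real where "k_y = 1 / \<beta>\<^sub>0 + 1 / chi + A_norm"
definition k_0 :: real where
  "k_0 = chi * z_bd + (1 + \<xi>) * \<xi> * \<beta>\<^sub>0 * z_bd + (2 + chi) * z_bd + C\<^sub>d * (gap / d_lo)"
definition M :: real where
  "M = d_hi * (2 * k_x\<^sup>2 * ell_hi * 2 / (\<theta> - 1) + 2 * k_y\<^sup>2 * (\<beta>\<^sub>0 * (1 + \<xi>)) / c_y)"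

lemma \<beta>_ge: "\<beta>\<^sub>0 \<le> \<beta> t"
  and \<beta>_mono: "\<beta> t \<le> \<beta> (Suc t)"
  and \<beta>_increment: "\<beta> (Suc t) \<le> \<beta> t + \<xi> * \<beta>\<^sub>0"
  and \<beta>_upper: "\<beta> (Suc t) \<le> \<beta>\<^sub>0 * (1 + \<xi>) * real (Suc t) powr p"
  and \<beta>_lower: "\<beta>\<^sub>0 * \<xi> * real t powr p \<le> \<beta> t"
  using penalty_growth[OF \<beta>\<^sub>0_pos \<xi>_pos p_pos p_lt_1] by auto

lemma \<beta>_pos: "0 < \<beta> t"
  using \<beta>_ge[of t] \<beta>\<^sub>0_pos by linarith

lemma \<beta>_ratio: "\<beta> (Suc t) \<le> (1 + \<xi>) * \<beta> t"
proof -
  have "\<xi> * \<beta>\<^sub>0 \<le> \<xi> * \<beta> t" using \<xi>_pos by (intro mult_left_mono \<beta>_ge) simp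
  then show ?thesis using \<beta>_increment[of t] by (simp add: algebra_simps)
qed

lemma inverse_\<beta>_ratio: "1 / \<beta> t \<le> (1 + \<xi>) / \<beta> (Suc t)"
  using \<beta>_ratio[of t] \<beta>_pos[of t] \<beta>_pos[of "Suc t"] by (simp add: field_simps)

lemma chi_pos: "0 < chi"
  using chi_large \<xi>_pos by (smt (verit) real_sqrt_ge_zero)

lemma \<mu>_pos: "0 < \<mu> t"
  using chi_pos \<beta>_pos by simp

lemma C\<^sub>h_nonneg: "0 \<le> C\<^sub>h" by (rule lipschitz_on_nonneg[OF h_lip])
lemma C\<^sub>d_nonneg: "0 \<le> C\<^sub>d" by (rule lipschitz_on_nonneg[OF d_lip])
lemma L\<^sub>f_nonneg: "0 \<le> L\<^sub>f" by (rule lipschitz_on_nonneg[OF f_grad])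

lemma C\<^sub>h_le_z_bd: "C\<^sub>h \<le> z_bd" by (simp add: z_bd_def)
lemma z_bd_nonneg: "0 \<le> z_bd" using C\<^sub>h_nonneg C\<^sub>h_le_z_bd by linarith
lemma d_hi_pos: "0 < d_hi" using d_bounds by linarith

lemma h_diff_le: "h u - h v \<le> z_bd * norm (u - v)"
proof -
  have "h u - h v \<le> C\<^sub>h * norm (u - v)"
    using lipschitz_onD[OF h_lip, of u v] by (simp add: dist_norm)
  also have "\<dots> \<le> z_bd * norm (u - v)"
    by (intro mult_right_mono C\<^sub>h_le_z_bd) simp
  finally show ?thesis .
qed

lemma envelope_bounds: "h v - \<mu> t / 2 * z_bd\<^sup>2 \<le> envelope h (\<mu> t) v" "envelope h (\<mu> t) v \<le> h v"
proof -
  have "\<mu> t / 2 * C\<^sub>h\<^sup>2 \<le> \<mu> t / 2 * z_bd\<^sup>2"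
    using \<mu>_pos[of t] C\<^sub>h_nonneg C\<^sub>h_le_z_bd by (intro mult_left_mono power_mono) auto
  then show "h v - \<mu> t / 2 * z_bd\<^sup>2 \<le> envelope h (\<mu> t) v"
    using envelope_ge[OF h_convex h_lip \<mu>_pos, of v t] by linarith
qed (rule envelope_le[OF h_convex h_lip \<mu>_pos])

text \<open>The lower bound on \<open>\<beta>\<^sub>0\<close> enters here. A positive Lagrangian
  makes the weights positive, so that linearising \<open>- w q\<close> at a subgradient bounds it
  from above up to a quadratic.\<close>

lemma U_lo_pos: "0 < U_lo"
proof -
  have Fd: "0 < F_lo * d_lo" using F_bounds d_bounds by simp
  have "(2 + chi / 2) * z_bd\<^sup>2 \<le> 8 * z_bd\<^sup>2 + 1 / 2 * chi * z_bd\<^sup>2"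
    by (simp add: algebra_simps)
  also have "\<dots> < \<beta>\<^sub>0 * (F_lo * d_lo)"
    using \<beta>\<^sub>0_large Fd by (simp add: z_bd_def[symmetric] pos_divide_less_eq)
  finally show ?thesis
    using \<beta>\<^sub>0_pos by (simp add: U_lo_def field_simps)
qed

lemma U_hi_pos: "0 < U_hi"
proof -
  have "0 < F_hi * d_hi" using F_bounds d_hi_pos by simp
  moreover have "0 \<le> (3 + \<xi>) * (2 * z_bd\<^sup>2 / \<beta>\<^sub>0)" using \<xi>_pos \<beta>\<^sub>0_pos by simp
  ultimately show ?thesis by (simp add: U_hi_def)
qed

lemma w_lo_pos: "0 < w_lo"
  using U_lo_pos d_hi_pos by (simp add: w_lo_def)

lemma w_hi_pos: "0 < w_hi"
  using U_hi_pos d_bounds by (simp add: w_hi_def less_max_iff_disj)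

text \<open>\<open>nondegenerate\<close> makes one of the three summands positive. Were all of them
  zero, the \<open>x\<close>-step would lose its proximal term, and a bound on
  \<open>ell t * dx t\<close> would say nothing about \<open>dx t\<close>.\<close>

lemma ell_lo_pos: "0 < ell_lo"
proof -
  have "0 \<le> \<beta>\<^sub>0 * A_norm\<^sup>2" "0 \<le> w_lo * W\<^sub>d" using \<beta>\<^sub>0_pos w_lo_pos W_nonneg by simp_all
  moreover have "0 < \<beta>\<^sub>0 * A_norm\<^sup>2 \<or> 0 < L\<^sub>f \<or> 0 < w_lo * W\<^sub>d"
  proof (cases "A = 0")
    case False
    then obtain v where "A *v v \<noteq> 0"
      by (metis matrix_eq matrix_vector_mult_0)
    then have "A_norm \<noteq> 0"
      using norm_matrix_vector_le[of A v] by auto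
    then show ?thesis using \<beta>\<^sub>0_pos by simp
  qed (use nondegenerate w_lo_pos in auto)
  ultimately show ?thesis using L\<^sub>f_nonneg by (auto simp: ell_lo_def)
qed

lemma ell_hi_nonneg: "0 \<le> ell_hi"
  using L\<^sub>f_nonneg \<beta>\<^sub>0_pos \<xi>_pos w_hi_pos W_nonneg by (simp add: ell_hi_def)

text \<open>The condition on \<open>chi\<close> gives \<open>chi\<^sup>2 > 4 * (1 + \<xi>)\<close>,
  which covers the required \<open>2 * (2 + \<xi>)\<close>.\<close>

lemma c_y_pos: "0 < c_y"
proof -
  have "(2 * sqrt (1 + \<xi>))\<^sup>2 < chi\<^sup>2"
    using chi_large \<xi>_pos by (intro power_strict_mono) auto
  then have "4 * (1 + \<xi>) < chi\<^sup>2" using \<xi>_pos by (simp add: power_mult_distrib)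
  then have "2 * (2 + \<xi>) < chi\<^sup>2" using \<xi>_pos by (simp add: distrib_left)
  then show ?thesis using chi_pos by (simp add: c_y_def field_simps)
qed

lemma \<kappa>_nonneg: "0 \<le> \<kappa>"
  using \<xi>_pos chi_pos by (simp add: \<kappa>_def)

lemma gap_nonneg: "0 \<le> gap"
  using \<xi>_pos chi_pos by (simp add: gap_def)

lemma total_pos: "0 < total"
  using U_hi_pos d_bounds \<kappa>_nonneg \<beta>\<^sub>0_pos by (simp add: total_def add_pos_nonneg)

lemma k_0_nonneg: "0 \<le> k_0"
  using z_bd_nonneg chi_pos \<xi>_pos \<beta>\<^sub>0_pos C\<^sub>d_nonneg gap_nonneg d_bounds by (simp add: k_0_def)

lemma M_nonneg: "0 \<le> M"
  using d_hi_pos ell_hi_nonneg \<theta>_gt_1 \<beta>\<^sub>0_pos \<xi>_pos c_y_pos by (simp add: M_def)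

text \<open>The factor \<open>2 powr p\<close> pays for an index as small as \<open>T / 2\<close>;
  the summands 1 make the constants positive.\<close>

definition K\<^sub>1 :: real where "K\<^sub>1 = k_0 * 2 powr p / (\<beta>\<^sub>0 * \<xi>) + 1"
definition K\<^sub>2 :: real where "K\<^sub>2 = sqrt (2 * M * total) + 1"

lemma K_pos: "0 < K\<^sub>1" "0 < K\<^sub>2"
  using k_0_nonneg \<beta>\<^sub>0_pos \<xi>_pos M_nonneg total_pos
  by (auto simp: K\<^sub>1_def K\<^sub>2_def intro!: add_nonneg_pos)

end

section \<open>Identities and multiplier bounds along a run\<close>

locale fadmm_iterates = fadmm_setting f g d \<delta> h A L\<^sub>f C\<^sub>h C\<^sub>d W\<^sub>d \<xi> \<theta> p chi \<beta>\<^sub>0 d_lo d_hi F_lo F_hi var z0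
  for f g d :: "real^'n \<Rightarrow> real" and \<delta> :: "real^'n \<Rightarrow> ereal" and h :: "real^'m \<Rightarrow> real"
    and A :: "real^'n^'m"
    and L\<^sub>f C\<^sub>h C\<^sub>d W\<^sub>d \<xi> \<theta> p chi \<beta>\<^sub>0 d_lo d_hi F_lo F_hi :: real
    and var :: fadmm_variant and z0 :: "real^'m" +
  fixes x :: "nat \<Rightarrow> real^'n" and yc y z :: "nat \<Rightarrow> real^'m"
  assumes z_start: "z 0 = z0"
    and run: "fadmm_run var f \<delta> g h d A L\<^sub>f W\<^sub>d \<theta> \<xi> p chi \<beta>\<^sub>0 x yc y z"
    and bounds: "\<And>t. d_lo \<le> d (x t)" "\<And>t. d (x t) \<le> d_hi"
      "\<And>t. ereal F_lo \<le> frac_obj f \<delta> g h d A (x t)" "\<And>t. frac_obj f \<delta> g h d A (x t) \<le> ereal F_hi"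
begin

definition U :: "nat \<Rightarrow> real" where
  "U t = real_of_ereal (smoothed_lagrangian f \<delta> g h A (x t) (y t) (z t) (\<beta> t) (\<mu> t))"
definition w :: "nat \<Rightarrow> real" where "w t = denom_weight var (U t) (d (x t))"
definition ell :: "nat \<Rightarrow> real" where "ell t = L\<^sub>f + \<beta> t * A_norm\<^sup>2 + w t * W\<^sub>d"
definition b :: "nat \<Rightarrow> real^'m" where "b t = A *v x (Suc t) + (1 / \<beta> t) *\<^sub>R z t"
definition dx :: "nat \<Rightarrow> real" where "dx t = norm (x (Suc t) - x t)"
definition dy :: "nat \<Rightarrow> real" where "dy t = norm (y (Suc t) - y t)"
definition dz :: "nat \<Rightarrow> real" where "dz t = norm (z (Suc t) - z t)"
abbreviation r\<delta> :: "nat \<Rightarrow> real" where "r\<delta> t \<equiv> real_of_ereal (\<delta> (x t))"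
abbreviation grad_s :: "nat \<Rightarrow> real^'n" where
  "grad_s t \<equiv> gradient (smooth_part f A (y t) (z t) (\<beta> t)) (x t)"

text \<open>The value after the \<open>x\<close>-step, with all other arguments still at time \<open>t\<close>.\<close>

definition V :: "nat \<Rightarrow> real" where
  "V t = smooth_part f A (y t) (z t) (\<beta> t) (x (Suc t)) + r\<delta> (Suc t) - g (x (Suc t))
     + envelope h (\<mu> t) (y t)"

lemma x_update: "x_update f \<delta> g A L\<^sub>f W\<^sub>d \<theta> (denom_part var d) (w t) (x t) (y t) (z t) (\<beta> t) (x (Suc t))"
  and yc_update: "yc (Suc t) \<in> Prox (b t) h (\<mu> t + 1 / \<beta> t)"
  and y_update: "y (Suc t) \<in> argmin_set (\<lambda>v. smoothed h (\<mu> t) v + ereal (\<beta> t / 2 * (norm (v - b t))\<^sup>2))"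
  and z_update: "z (Suc t) = z t + \<beta> t *\<^sub>R (A *v x (Suc t) - y (Suc t))"
  using run unfolding fadmm_run_def Let_def w_def U_def b_def by blast+

lemma d_pos: "0 < d (x t)"
  using bounds(1)[of t] d_bounds by linarith

lemma \<delta>_real: "\<delta> (x t) = ereal (r\<delta> t)"
proof -
  have "\<delta> (x t) \<noteq> - \<infinity>" using \<delta>_proper by (simp add: proper_fun_def)
  moreover have "\<delta> (x t) \<noteq> \<infinity>"
    using bounds(4)[of t] d_pos[of t] by (auto simp: frac_obj_def numer_def)
  ultimately show ?thesis by (cases "\<delta> (x t)") auto
qed

lemma numer_bounds:
  "F_lo * d_lo \<le> f (x t) + r\<delta> t - g (x t) + h (A *v x t)"
  "f (x t) + r\<delta> t - g (x t) + h (A *v x t) \<le> F_hi * d_hi"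
proof -
  let ?u = "f (x t) + r\<delta> t - g (x t) + h (A *v x t)"
  have "numer f \<delta> g h A (x t) = ereal ?u"
    unfolding numer_def by (subst \<delta>_real) simp
  then have u: "frac_obj f \<delta> g h d A (x t) = ereal (?u / d (x t))"
    using d_pos[of t] by (simp add: frac_obj_def)
  then have "F_lo * d (x t) \<le> ?u" "?u \<le> F_hi * d (x t)"
    using bounds(3,4)[of t] d_pos[of t] by (simp_all add: pos_le_divide_eq pos_divide_le_eq)
  moreover have "F_lo * d_lo \<le> F_lo * d (x t)" "F_hi * d (x t) \<le> F_hi * d_hi"
    using bounds(1,2)[of t] F_bounds by (intro mult_left_mono; simp)+
  ultimately show "F_lo * d_lo \<le> ?u" "?u \<le> F_hi * d_hi" by linarith+
qed

lemma U_eq: "U t = smooth_part f A (y t) (z t) (\<beta> t) (x t) + r\<delta> t - g (x t) + envelope h (\<mu> t) (y t)"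
  unfolding U_def smoothed_lagrangian_def
  by (subst \<delta>_real, subst smoothed_eq_envelope[OF h_convex h_lip \<mu>_pos]) simp

lemma residual: "A *v x (Suc t) - y (Suc t) = (1 / \<beta> t) *\<^sub>R (z (Suc t) - z t)"
  using \<beta>_pos[of t] by (simp add: z_update)

text \<open>The proximal point supplies a subgradient \<open>v\<close> and the decomposition of
  \<open>b t\<close>; minimality then determines \<open>y (Suc t)\<close>; and the multiplier update
  amounts to \<open>z (Suc t) = \<beta> t *\<^sub>R (b t - y (Suc t))\<close>, which equals
  \<open>v\<close>. Hence multipliers stay bounded although the penalty grows.\<close>

lemma z_subgradient: "convex_subgradient h (yc (Suc t)) (z (Suc t))"
  and b_eq: "b t = yc (Suc t) + (\<mu> t + 1 / \<beta> t) *\<^sub>R z (Suc t)"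
  and y_eq: "y (Suc t) = yc (Suc t) + \<mu> t *\<^sub>R z (Suc t)"
proof -
  have pos: "0 < \<mu> t" "0 < \<beta> t" "0 < \<mu> t + 1 / \<beta> t"
    using \<mu>_pos[of t] \<beta>_pos[of t] by (simp_all add: add_pos_pos)
  define v where "v = (1 / (\<mu> t + 1 / \<beta> t)) *\<^sub>R (b t - yc (Suc t))"
  have v: "convex_subgradient h (yc (Suc t)) v"
    unfolding v_def by (rule Prox_convex_subgradient[OF h_convex pos(3) yc_update])
  have b: "b t = yc (Suc t) + (\<mu> t + 1 / \<beta> t) *\<^sub>R v"
    using pos(3) by (simp add: v_def)
  have y: "y (Suc t) = yc (Suc t) + \<mu> t *\<^sub>R v"
    by (rule argmin_envelope_penalised[OF h_convex h_lip pos(1,2) v b y_update])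
  have "b t - y (Suc t) = (1 / \<beta> t) *\<^sub>R v"
    by (simp add: b y scaleR_add_left)
  moreover have "z (Suc t) = \<beta> t *\<^sub>R (b t - y (Suc t))"
    using pos(2) by (simp add: z_update b_def scaleR_diff_right scaleR_add_right)
  ultimately have "z (Suc t) = v" using pos(2) by simp
  then show "convex_subgradient h (yc (Suc t)) (z (Suc t))"
    "b t = yc (Suc t) + (\<mu> t + 1 / \<beta> t) *\<^sub>R z (Suc t)"
    "y (Suc t) = yc (Suc t) + \<mu> t *\<^sub>R z (Suc t)"
    using v b y by simp_all
qed

text \<open>From index 1 on the multiplier is a subgradient of the Lipschitz function
  \<open>h\<close>; index 0 is the reason for the maximum in \<open>z_bd\<close>.\<close>

lemma norm_z_le: "norm (z t) \<le> z_bd"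
proof (cases t)
  case (Suc s)
  then show ?thesis
    using convex_subgradient_norm_le[OF h_lip z_subgradient[of s]] C\<^sub>h_le_z_bd by simp
qed (simp add: z_start z_bd_def)

lemma dz_le: "dz t \<le> 2 * z_bd"
  using norm_triangle_ineq4[of "z (Suc t)" "z t"] norm_z_le[of t] norm_z_le[of "Suc t"]
  by (simp add: dz_def)

lemma norm_residual: "norm (A *v x (Suc t) - y (Suc t)) = dz t / \<beta> t"
  using \<beta>_pos[of t] by (simp add: residual dz_def)

lemma residual_small:
  "norm (A *v x (Suc t) - y (Suc t)) \<le> 2 * z_bd / \<beta> t"
  "\<beta> (Suc t) / 2 * (norm (A *v x (Suc t) - y (Suc t)))\<^sup>2
     \<le> (1 + \<xi>) * (z_bd * norm (A *v x (Suc t) - y (Suc t)))"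
proof -
  let ?r = "norm (A *v x (Suc t) - y (Suc t))"
  show r: "?r \<le> 2 * z_bd / \<beta> t"
    using dz_le[of t] \<beta>_pos[of t] by (simp add: norm_residual divide_right_mono)
  \<comment> \<open>The residual is measured with \<open>\<beta> t\<close>, but the next Lagrangian
    carries \<open>\<beta> (Suc t)\<close>; their bounded ratio costs the factor
    \<open>1 + \<xi>\<close>.\<close>
  have "\<beta> (Suc t) * ?r \<le> (1 + \<xi>) * \<beta> t * ?r"
    by (intro mult_right_mono \<beta>_ratio) simp
  also have "\<dots> = (1 + \<xi>) * (\<beta> t * ?r)" by simp
  also have "\<dots> \<le> (1 + \<xi>) * (2 * z_bd)"
    using r \<beta>_pos[of t] \<xi>_pos by (intro mult_left_mono) (simp_all add: field_simps)
  finally have "\<beta> (Suc t) * ?r * (?r / 2) \<le> (1 + \<xi>) * (2 * z_bd) * (?r / 2)"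
    by (intro mult_right_mono) auto
  then show "\<beta> (Suc t) / 2 * ?r\<^sup>2 \<le> (1 + \<xi>) * (z_bd * ?r)"
    by (simp add: power2_eq_square)
qed

lemma inner_z_le: "\<bar>v \<bullet> z t\<bar> \<le> z_bd * norm v"
proof -
  have "\<bar>v \<bullet> z t\<bar> \<le> norm v * norm (z t)" by (rule Cauchy_Schwarz_ineq2)
  also have "\<dots> \<le> norm v * z_bd" by (intro mult_left_mono norm_z_le) simp
  finally show ?thesis by (simp add: mult.commute)
qed

section \<open>A priori bounds on the Lagrangian and the weights\<close>

text \<open>Index 0 is included, where the residual is arbitrary. The penalty therefore absorbs the
  linear term \<open>2 * (z_bd * r)\<close> by completing the square; half of that term stems from
  the multiplier, half from passing between \<open>h (A *v x t)\<close> and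
  \<open>h (y t)\<close>.\<close>

lemma U_ge: "U_lo \<le> U t"
proof -
  define r where "r = norm (A *v x t - y t)"
  have "0 \<le> \<beta> t / 2 * (r - 2 * z_bd / \<beta> t)\<^sup>2" using \<beta>_pos[of t] by simp
  also have "\<dots> = \<beta> t / 2 * r\<^sup>2 - 2 * (z_bd * r) + 2 * z_bd\<^sup>2 / \<beta> t"
    using \<beta>_pos[of t] by (simp add: power2_eq_square field_simps)
  finally have "2 * (z_bd * r) \<le> \<beta> t / 2 * r\<^sup>2 + 2 * z_bd\<^sup>2 / \<beta> t" by simp
  moreover have "h (A *v x t) - h (y t) \<le> z_bd * r" unfolding r_def by (rule h_diff_le)
  moreover have "(2 + chi / 2) * z_bd\<^sup>2 / \<beta> t = 2 * z_bd\<^sup>2 / \<beta> t + \<mu> t / 2 * z_bd\<^sup>2"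
    using \<beta>_pos[of t] by (simp add: field_simps)
  moreover have "(2 + chi / 2) * z_bd\<^sup>2 / \<beta> t \<le> (2 + chi / 2) * z_bd\<^sup>2 / \<beta>\<^sub>0"
    using \<beta>_ge[of t] \<beta>\<^sub>0_pos chi_pos by (intro divide_left_mono) auto
  ultimately show ?thesis
    using numer_bounds(1)[of t] envelope_bounds(1)[of "y t" t] inner_z_le[of "A *v x t - y t" t]
    unfolding U_lo_def U_eq smooth_part_def r_def[symmetric] by linarith
qed

lemma U_pos: "0 < U t"
  using U_ge[of t] U_lo_pos by linarith

text \<open>Stated from index 1 on, as it rests on the residual bound after a completed
  step.\<close>

lemma U_le: "U (Suc t) \<le> U_hi"
proof -
  define r where "r = norm (A *v x (Suc t) - y (Suc t))"
  have "(3 + \<xi>) * (z_bd * r) \<le> (3 + \<xi>) * (2 * z_bd\<^sup>2 / \<beta>\<^sub>0)"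
  proof (rule mult_left_mono)
    have "z_bd * r \<le> z_bd * (2 * z_bd / \<beta> t)"
      unfolding r_def by (intro mult_left_mono residual_small z_bd_nonneg)
    also have "\<dots> = 2 * z_bd\<^sup>2 / \<beta> t" by (simp add: power2_eq_square)
    also have "\<dots> \<le> 2 * z_bd\<^sup>2 / \<beta>\<^sub>0"
      using \<beta>_ge[of t] \<beta>\<^sub>0_pos by (intro divide_left_mono) auto
    finally show "z_bd * r \<le> 2 * z_bd\<^sup>2 / \<beta>\<^sub>0" .
  qed (use \<xi>_pos in simp)
  moreover have "h (y (Suc t)) - h (A *v x (Suc t)) \<le> z_bd * r"
    using h_diff_le[of "y (Suc t)" "A *v x (Suc t)"] by (simp add: r_def norm_minus_commute)
  moreover have "\<beta> (Suc t) / 2 * r\<^sup>2 \<le> (1 + \<xi>) * (z_bd * r)"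
    unfolding r_def by (rule residual_small)
  moreover have "(3 + \<xi>) * (z_bd * r) = 2 * (z_bd * r) + (1 + \<xi>) * (z_bd * r)"
    by (simp add: algebra_simps)
  ultimately show ?thesis
    using numer_bounds(2)[of "Suc t"] envelope_bounds(2)[of "Suc t" "y (Suc t)"]
      inner_z_le[of "A *v x (Suc t) - y (Suc t)" "Suc t"]
    unfolding U_hi_def U_eq smooth_part_def r_def[symmetric] by linarith
qed

text \<open>The algorithm weighs by \<open>U / d\<close>; the criticality measure uses
  \<open>split_ratio\<close>, with \<open>h\<close> in place of the envelope and without residual
  terms. Smoothing and residual are of order \<open>1 / \<beta>\<close>, and
  \<open>inverse_\<beta>_ratio\<close> moves the bound to the newer index.\<close>

lemma ratio_gap:
  "\<bar>U (Suc t) / d (x (Suc t)) - split_ratio f \<delta> g h d (x (Suc t)) (y (Suc t))\<bar>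
     \<le> gap / d_lo / \<beta> (Suc t)"
proof -
  define r where "r = norm (A *v x (Suc t) - y (Suc t))"
  define u where "u = f (x (Suc t)) + r\<delta> (Suc t) - g (x (Suc t)) + h (y (Suc t))"
  have split: "split_ratio f \<delta> g h d (x (Suc t)) (y (Suc t)) = u / d (x (Suc t))"
    unfolding split_ratio_def u_def by (subst \<delta>_real) simp
  have "(2 + \<xi>) * (z_bd * r) \<le> (2 + \<xi>) * ((1 + \<xi>) * (2 * z_bd\<^sup>2) / \<beta> (Suc t))"
  proof (rule mult_left_mono)
    have "z_bd * r \<le> z_bd * (2 * z_bd / \<beta> t)"
      unfolding r_def by (intro mult_left_mono residual_small z_bd_nonneg)
    also have "\<dots> = 2 * z_bd\<^sup>2 * (1 / \<beta> t)" by (simp add: power2_eq_square)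
    also have "\<dots> \<le> 2 * z_bd\<^sup>2 * ((1 + \<xi>) / \<beta> (Suc t))"
      by (intro mult_left_mono inverse_\<beta>_ratio) simp
    finally show "z_bd * r \<le> (1 + \<xi>) * (2 * z_bd\<^sup>2) / \<beta> (Suc t)" by (simp add: mult.commute)
  qed (use \<xi>_pos in simp)
  moreover have "\<beta> (Suc t) / 2 * r\<^sup>2 \<le> (1 + \<xi>) * (z_bd * r)"
    unfolding r_def by (rule residual_small)
  moreover have "0 \<le> \<beta> (Suc t) / 2 * r\<^sup>2" using \<beta>_pos[of "Suc t"] by simp
  moreover have "(2 + \<xi>) * (z_bd * r) = z_bd * r + (1 + \<xi>) * (z_bd * r)"
    by (simp add: algebra_simps)
  moreover have "gap / \<beta> (Suc t) = (2 + \<xi>) * ((1 + \<xi>) * (2 * z_bd\<^sup>2) / \<beta> (Suc t)) + \<mu> (Suc t) / 2 * z_bd\<^sup>2"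
    by (simp add: gap_def add_divide_distrib algebra_simps)
  moreover have "0 \<le> \<mu> (Suc t) / 2 * z_bd\<^sup>2"
    using \<mu>_pos[of "Suc t"] by (intro mult_nonneg_nonneg) auto
  ultimately have "\<bar>U (Suc t) - u\<bar> \<le> gap / \<beta> (Suc t)"
    using envelope_bounds[where t = "Suc t" and v = "y (Suc t)"]
      inner_z_le[of "A *v x (Suc t) - y (Suc t)" "Suc t"]
    unfolding u_def U_eq smooth_part_def r_def[symmetric] abs_le_iff by linarith
  then have "\<bar>U (Suc t) - u\<bar> / d (x (Suc t)) \<le> gap / \<beta> (Suc t) / d_lo"
    using d_bounds bounds(1)[of "Suc t"] by (intro frac_le) auto
  moreover have "\<bar>U (Suc t) / d (x (Suc t)) - u / d (x (Suc t))\<bar> = \<bar>U (Suc t) - u\<bar> / d (x (Suc t))"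
    using d_pos[of "Suc t"] by (simp add: diff_divide_distrib[symmetric])
  ultimately show ?thesis unfolding split by (simp add: mult.commute)
qed

lemma w_pos: "0 < w t"
  unfolding w_def by (intro denom_weight_pos U_pos d_pos)

lemma w_ge: "w_lo \<le> w t"
proof -
  have "U_lo / d_hi \<le> U t / d (x t)"
    using U_ge[of t] U_pos[of t] d_pos bounds(2) by (intro frac_le) (auto simp: less_imp_le)
  moreover have "2 * U_lo / sqrt d_hi \<le> 2 * U t / sqrt (d (x t))"
    using U_ge U_pos[of t] d_pos bounds(2) by (intro frac_le) (auto simp: less_imp_le)
  ultimately show ?thesis
    unfolding w_def w_lo_def denom_weight_def by (cases var) auto
qed

lemma w_le: "w (Suc t) \<le> w_hi"
proof -
  have "U (Suc t) / d (x (Suc t)) \<le> U_hi / d_lo"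
    using U_le U_hi_pos d_bounds bounds(1) by (intro frac_le) auto
  moreover have "2 * U (Suc t) / sqrt (d (x (Suc t))) \<le> 2 * U_hi / sqrt d_lo"
    using U_le U_hi_pos d_bounds bounds(1) by (intro frac_le) auto
  ultimately show ?thesis
    unfolding w_def w_hi_def denom_weight_def by (cases var) auto
qed

lemma ell_ge: "ell_lo \<le> ell t"
  unfolding ell_lo_def ell_def
  by (intro add_mono mult_right_mono \<beta>_ge w_ge order_refl W_nonneg zero_le_power2)

lemma ell_pos: "0 < ell t"
  using ell_ge[of t] ell_lo_pos by linarith

lemma one_le_powr: "1 \<le> real (Suc t) powr p"
  using p_pos by (intro ge_one_powr_ge_zero) auto

lemma ell_le: "ell (Suc t) \<le> ell_hi * real (Suc t) powr p"
proof -
  define P where "P = real (Suc t) powr p"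
  have P: "1 \<le> P" unfolding P_def by (rule one_le_powr)
  have "L\<^sub>f \<le> L\<^sub>f * P" using P L\<^sub>f_nonneg mult_left_mono[of 1 P "L\<^sub>f"] by simp
  moreover have "\<beta> (Suc t) * A_norm\<^sup>2 \<le> \<beta>\<^sub>0 * (1 + \<xi>) * P * A_norm\<^sup>2"
    unfolding P_def by (intro mult_right_mono \<beta>_upper) simp
  moreover have "w (Suc t) * W\<^sub>d \<le> w_hi * W\<^sub>d" by (intro mult_right_mono w_le W_nonneg)
  moreover have "w_hi * W\<^sub>d \<le> w_hi * W\<^sub>d * P"
    using P w_hi_pos W_nonneg mult_left_mono[of 1 P "w_hi * W\<^sub>d"] by simp
  moreover have "ell_hi * P = L\<^sub>f * P + \<beta>\<^sub>0 * (1 + \<xi>) * P * A_norm\<^sup>2 + w_hi * W\<^sub>d * P"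
    by (simp add: ell_hi_def algebra_simps)
  ultimately show ?thesis unfolding ell_def P_def[symmetric] by linarith
qed

section \<open>Descent in one iteration\<close>

text \<open>The surplus of the proximal weight \<open>\<theta> * ell t / 2\<close> over the
  curvature \<open>ell t / 2\<close> that the linearisation errors consume.\<close>

definition E\<^sub>x :: "nat \<Rightarrow> real" where "E\<^sub>x t = (\<theta> - 1) / 2 * ell t * (dx t)\<^sup>2"

text \<open>Minimality is used twice. Around \<open>x (Suc t)\<close> it yields the subgradient of
  \<delta>; against the competitor \<open>x t\<close> it yields the decrease, since the linear
  models of the smooth part, \<open>- g\<close> and \<open>- w t * q\<close> are upper bounds up to
  a total error \<open>ell t / 2 * (dx t)\<^sup>2\<close>.\<close>

lemma x_step:
  obtains \<zeta>\<^sub>g \<zeta>\<^sub>d where "\<zeta>\<^sub>g \<in> subdiff g (x t)" "\<zeta>\<^sub>d \<in> subdiff d (x t)"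
    "- (grad_s t - \<zeta>\<^sub>g - (U t / d (x t)) *\<^sub>R \<zeta>\<^sub>d + (\<theta> * ell t) *\<^sub>R (x (Suc t) - x t))
       \<in> limiting_subdiff \<delta> (x (Suc t))"
    "V t / d (x (Suc t)) \<le> U t / d (x t) - E\<^sub>x t / d (x (Suc t))"
proof -
  let ?x = "x t" and ?x' = "x (Suc t)" and ?q = "denom_part var d"
  obtain \<zeta>\<^sub>g \<zeta> where g: "\<zeta>\<^sub>g \<in> subdiff g ?x" and q: "\<zeta> \<in> subdiff ?q ?x"
    and argmin: "?x' \<in> argmin_set (\<lambda>u. \<delta> u + ereal ((u - ?x) \<bullet> (grad_s t - \<zeta>\<^sub>g - w t *\<^sub>R \<zeta>)
        + \<theta> * ell t / 2 * (norm (u - ?x))\<^sup>2))"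
    using x_update[of t] unfolding x_update_def ell_def by blast
  obtain \<zeta>\<^sub>d where d: "\<zeta>\<^sub>d \<in> subdiff d ?x" "w t *\<^sub>R \<zeta> = (U t / d ?x) *\<^sub>R \<zeta>\<^sub>d"
    using denom_subgradient[OF d_nonneg d_pos U_pos q] unfolding w_def by blast
  have "\<bar>\<delta> ?x'\<bar> \<noteq> \<infinity>" by (subst \<delta>_real) simp
  with argmin have "- (grad_s t - \<zeta>\<^sub>g - w t *\<^sub>R \<zeta> + (\<theta> * ell t) *\<^sub>R (?x' - ?x)) \<in> limiting_subdiff \<delta> ?x'"
    by (rule prox_linear_subgradient)
  moreover have "V t / d ?x' \<le> U t / d ?x - E\<^sub>x t / d ?x'"
  proof (rule ratio_decrease[where d = d and x = ?x and x' = ?x' and U = "U t", OF d_pos d_pos U_pos])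
    have "\<delta> ?x' + ereal ((?x' - ?x) \<bullet> (grad_s t - \<zeta>\<^sub>g - w t *\<^sub>R \<zeta>)
        + \<theta> * ell t / 2 * (norm (?x' - ?x))\<^sup>2)
      \<le> \<delta> u + ereal ((u - ?x) \<bullet> (grad_s t - \<zeta>\<^sub>g - w t *\<^sub>R \<zeta>)
        + \<theta> * ell t / 2 * (norm (u - ?x))\<^sup>2)" for u
      using argmin unfolding argmin_set_def is_arg_min_linorder by blast
    from this[of ?x] have "\<delta> ?x' + ereal ((?x' - ?x) \<bullet> (grad_s t - \<zeta>\<^sub>g - w t *\<^sub>R \<zeta>)
        + \<theta> * ell t / 2 * (norm (?x' - ?x))\<^sup>2) \<le> \<delta> ?x"
      by simp
    then have "ereal (r\<delta> (Suc t)) + ereal ((?x' - ?x) \<bullet> (grad_s t - \<zeta>\<^sub>g - w t *\<^sub>R \<zeta>)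
        + \<theta> * ell t / 2 * (norm (?x' - ?x))\<^sup>2) \<le> ereal (r\<delta> t)"
      by (simp only: \<delta>_real[symmetric])
    then have \<delta>: "r\<delta> (Suc t) + (?x' - ?x) \<bullet> (grad_s t - \<zeta>\<^sub>g - w t *\<^sub>R \<zeta>)
        + \<theta> * ell t / 2 * (dx t)\<^sup>2 \<le> r\<delta> t"
      by (simp add: dx_def)
    have s: "smooth_part f A (y t) (z t) (\<beta> t) ?x' \<le> smooth_part f A (y t) (z t) (\<beta> t) ?x
        + (?x' - ?x) \<bullet> grad_s t + (L\<^sub>f + \<beta> t * A_norm\<^sup>2) / 2 * (dx t)\<^sup>2"
      unfolding dx_def using \<beta>_pos[of t] by (intro smooth_part_upper_bound f_diff f_grad) simp
    have gs: "g ?x + \<zeta>\<^sub>g \<bullet> (?x' - ?x) \<le> g ?x'"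
      by (rule subgradient_convex[OF g_convex g])
    have "w t * (?q ?x + \<zeta> \<bullet> (?x' - ?x) - W\<^sub>d / 2 * (dx t)\<^sup>2) \<le> w t * ?q ?x'"
      unfolding dx_def using w_pos[of t]
      by (intro mult_left_mono subgradient_weakly_convex[OF q_weakly_convex q]) simp
    then have qs: "w t * ?q ?x + w t * (\<zeta> \<bullet> (?x' - ?x)) - w t * W\<^sub>d / 2 * (dx t)\<^sup>2 \<le> w t * ?q ?x'"
      by (simp add: algebra_simps)
    have "(?x' - ?x) \<bullet> (grad_s t - \<zeta>\<^sub>g - w t *\<^sub>R \<zeta>)
        = (?x' - ?x) \<bullet> grad_s t - \<zeta>\<^sub>g \<bullet> (?x' - ?x) - w t * (\<zeta> \<bullet> (?x' - ?x))"
      unfolding inner_diff_right[of "?x' - ?x"] inner_scaleR_right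
      by (simp only: inner_commute[of "?x' - ?x"])
    moreover have "E\<^sub>x t = \<theta> * ell t / 2 * (dx t)\<^sup>2
        - (L\<^sub>f + \<beta> t * A_norm\<^sup>2) / 2 * (dx t)\<^sup>2 - w t * W\<^sub>d / 2 * (dx t)\<^sup>2"
      by (simp add: E\<^sub>x_def ell_def field_simps)
    ultimately have "V t - w t * ?q ?x' \<le> U t - w t * ?q ?x - E\<^sub>x t"
      using \<delta> s gs qs unfolding V_def U_eq by linarith
    then show "V t - denom_weight var (U t) (d ?x) * ?q ?x'
        \<le> U t - denom_weight var (U t) (d ?x) * ?q ?x - E\<^sub>x t"
      unfolding w_def .
  qed
  ultimately show ?thesis using that g d by (simp only: d(2))
qed

text \<open>Monotonicity of subgradients is applied at consecutive proximal points. By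
  \<open>y_eq\<close> their difference is the \<open>y\<close>-step, plus a drift of the smoothing
  parameter, minus \<open>\<mu> (Suc t)\<close> times the multiplier step; the last part supplies
  the square. Two multipliers that are subgradients are needed, hence the index
  \<open>Suc t\<close>.\<close>

lemma dz_bound:
  "dz (Suc t) \<le> \<beta> (Suc t) / chi * dy (Suc t) + z_bd * (\<beta> (Suc t) * (1 / \<beta> t - 1 / \<beta> (Suc t)))"
proof -
  let ?\<mu> = "\<mu> t" and ?\<mu>' = "\<mu> (Suc t)"
  define e where "e = z (Suc (Suc t)) - z (Suc t)"
  have pos: "0 < ?\<mu>'" "0 < \<beta> (Suc t)" "0 < chi" using \<mu>_pos \<beta>_pos chi_pos by blast+
  have "0 \<le> e \<bullet> (yc (Suc (Suc t)) - yc (Suc t))"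
    unfolding e_def by (rule convex_subgradient_monotone[OF z_subgradient z_subgradient])
  also have "yc (Suc (Suc t)) - yc (Suc t)
      = (y (Suc (Suc t)) - y (Suc t)) + (?\<mu> - ?\<mu>') *\<^sub>R z (Suc t) - ?\<mu>' *\<^sub>R e"
    by (simp add: y_eq e_def algebra_simps)
  also have "e \<bullet> \<dots> = e \<bullet> ((y (Suc (Suc t)) - y (Suc t)) + (?\<mu> - ?\<mu>') *\<^sub>R z (Suc t)) - ?\<mu>' * (norm e)\<^sup>2"
    by (simp only: inner_diff_right inner_scaleR_right power2_norm_eq_inner)
  finally have "?\<mu>' * (norm e)\<^sup>2 \<le> norm e * norm ((y (Suc (Suc t)) - y (Suc t)) + (?\<mu> - ?\<mu>') *\<^sub>R z (Suc t))"
    using norm_cauchy_schwarz[of e] by (smt (verit))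
  also have "\<dots> \<le> norm e * (dy (Suc t) + (?\<mu> - ?\<mu>') * z_bd)"
  proof (rule mult_left_mono)
    have le: "0 \<le> ?\<mu> - ?\<mu>'"
      using \<beta>_mono[of t] \<beta>_pos[of t] chi_pos by (simp add: divide_left_mono)
    have "norm ((?\<mu> - ?\<mu>') *\<^sub>R z (Suc t)) \<le> (?\<mu> - ?\<mu>') * z_bd"
      unfolding norm_scaleR using le by (simp add: mult_left_mono norm_z_le del: norm_scaleR)
    then show "norm ((y (Suc (Suc t)) - y (Suc t)) + (?\<mu> - ?\<mu>') *\<^sub>R z (Suc t))
        \<le> dy (Suc t) + (?\<mu> - ?\<mu>') * z_bd"
      unfolding dy_def by (intro norm_triangle_le add_left_mono)
  qed simp
  finally have cancel: "norm e * (?\<mu>' * norm e) \<le> norm e * (dy (Suc t) + (?\<mu> - ?\<mu>') * z_bd)"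
    by (simp add: power2_eq_square algebra_simps)
  have "0 \<le> (?\<mu> - ?\<mu>') * z_bd"
    using \<beta>_mono[of t] \<beta>_pos[of t] chi_pos z_bd_nonneg
    by (intro mult_nonneg_nonneg) (simp_all add: divide_left_mono)
  then have nonneg: "0 \<le> dy (Suc t) + (?\<mu> - ?\<mu>') * z_bd" by (simp add: dy_def)
  have "?\<mu>' * norm e \<le> dy (Suc t) + (?\<mu> - ?\<mu>') * z_bd"
  proof (cases "e = 0")
    case False
    then have "0 < norm e" by simp
    with cancel show ?thesis by (rule mult_left_le_imp_le)
  qed (use nonneg in \<open>simp only: norm_zero mult_zero_right\<close>)
  then have "norm e \<le> (dy (Suc t) + (?\<mu> - ?\<mu>') * z_bd) / ?\<mu>'"
    unfolding pos_le_divide_eq[OF pos(1)] by (simp only: mult.commute)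
  also have "\<dots> = \<beta> (Suc t) / chi * dy (Suc t) + z_bd * (\<beta> (Suc t) * (1 / \<beta> t - 1 / \<beta> (Suc t)))"
    using pos(2,3) \<beta>_pos[of t] by (simp add: field_simps)
  finally show ?thesis by (simp add: dz_def e_def)
qed

text \<open>Since \<open>\<beta> (Suc t) * (1 / \<beta> t - 1 / \<beta> (Suc t)) \<le> \<xi>\<close>, the squared parameter drift is
  bounded by a telescoping difference.\<close>

lemma dz_squared_bound:
  "(1 + \<xi> / 2) / \<beta> (Suc t) * (dz (Suc t))\<^sup>2 \<le> (1 / 2 - c_y) * \<beta> (Suc t) * (dy (Suc t))\<^sup>2
     + (2 + \<xi>) * \<xi> * z_bd\<^sup>2 * (1 / \<beta> t - 1 / \<beta> (Suc t))"
proof -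
  define e where "e = 1 / \<beta> t - 1 / \<beta> (Suc t)"
  define B where "B = \<beta> (Suc t)"
  have B: "0 < B" unfolding B_def by (rule \<beta>_pos)
  have e: "0 \<le> e" using \<beta>_mono[of t] \<beta>_pos[of t] by (simp add: e_def divide_left_mono)
  have "B / \<beta> t \<le> 1 + \<xi>"
    using \<beta>_ratio[of t] \<beta>_pos[of t] by (simp add: B_def pos_divide_le_eq)
  moreover have "B * e = B / \<beta> t - 1" using B by (simp add: e_def B_def right_diff_distrib)
  ultimately have "B * e \<le> \<xi>" by simp
  then have Be: "B * e * e \<le> \<xi> * e" using e by (rule mult_right_mono)
  define P Q where "P = B / chi * dy (Suc t)" and "Q = z_bd * (B * e)"
  have "(dz (Suc t))\<^sup>2 \<le> (P + Q)\<^sup>2"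
    using dz_bound[of t] unfolding P_def Q_def B_def e_def
    by (intro power_mono) (simp_all add: dz_def)
  also have "\<dots> \<le> 2 * P\<^sup>2 + 2 * Q\<^sup>2"
    using zero_le_power2[of "P - Q"] by (simp add: power2_eq_square algebra_simps)
  finally have "(1 + \<xi> / 2) / B * (dz (Suc t))\<^sup>2 \<le> (1 + \<xi> / 2) / B * (2 * P\<^sup>2 + 2 * Q\<^sup>2)"
    using B \<xi>_pos by (intro mult_left_mono) auto
  \<comment> \<open>The 2 from splitting the square meets \<open>1 + \<xi> / 2\<close>: this is the
    \<open>2 + \<xi>\<close> in \<open>c_y\<close> and \<kappa>.\<close>
  also have "\<dots> = (2 + \<xi>) / chi\<^sup>2 * B * (dy (Suc t))\<^sup>2 + (2 + \<xi>) * z_bd\<^sup>2 * (B * e * e)"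
    using B chi_pos by (simp add: P_def Q_def field_simps power2_eq_square)
  also have "\<dots> \<le> (2 + \<xi>) / chi\<^sup>2 * B * (dy (Suc t))\<^sup>2 + (2 + \<xi>) * z_bd\<^sup>2 * (\<xi> * e)"
    using \<xi>_pos by (intro add_left_mono mult_left_mono Be) simp
  also have "\<dots> = (1 / 2 - c_y) * B * (dy (Suc t))\<^sup>2 + (2 + \<xi>) * \<xi> * z_bd\<^sup>2 * e"
    by (simp add: c_y_def)
  finally show ?thesis unfolding B_def e_def .
qed

text \<open>Four changes are accounted for: the \<open>y\<close>-step gains by quadratic growth, the
  new multiplier costs exactly \<open>(dz t)\<^sup>2 / \<beta> t\<close>, raising the penalty adds
  at most \<open>\<xi> / 2\<close> times that amount, and lowering the smoothing parameter costs the
  last term.\<close>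

lemma yz_step:
  "U (Suc t) \<le> V t - \<beta> t / 2 * (dy t)\<^sup>2 + (1 + \<xi> / 2) / \<beta> t * (dz t)\<^sup>2
     + chi / 2 * z_bd\<^sup>2 * (1 / \<beta> t - 1 / \<beta> (Suc t))"
proof -
  let ?x = "x (Suc t)" and ?y = "y (Suc t)" and ?z = "z (Suc t)"
  have B: "0 < \<beta> t" "0 < \<beta> (Suc t)" by (rule \<beta>_pos)+
  \<comment> \<open>Completing the square: the two penalised forms differ by a term free of
    \<open>v\<close>, which cancels when two values are compared.\<close>
  have square: "\<beta> t / 2 * (norm (v - b t))\<^sup>2
      = (A *v ?x - v) \<bullet> z t + \<beta> t / 2 * (norm (A *v ?x - v))\<^sup>2 + 1 / (2 * \<beta> t) * (norm (z t))\<^sup>2" for v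
  proof -
    have "b t - v = (A *v ?x - v) + (1 / \<beta> t) *\<^sub>R z t" by (simp add: b_def)
    then have "(norm (v - b t))\<^sup>2 = (norm ((A *v ?x - v) + (1 / \<beta> t) *\<^sub>R z t))\<^sup>2"
      by (simp only: norm_minus_commute[of v])
    also have "\<dots> = (norm (A *v ?x - v))\<^sup>2 + 2 / \<beta> t * ((A *v ?x - v) \<bullet> z t)
        + (1 / \<beta> t)\<^sup>2 * (norm (z t))\<^sup>2"
      unfolding power2_norm_eq_inner
      by (simp add: inner_add_left inner_add_right inner_commute power2_eq_square)
    finally show ?thesis using B by (simp add: field_simps power2_eq_square)
  qed
  have "envelope h (\<mu> t) ?y + \<beta> t / 2 * (norm (?y - b t))\<^sup>2 + \<beta> t / 2 * (norm (y t - ?y))\<^sup>2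
      \<le> envelope h (\<mu> t) (y t) + \<beta> t / 2 * (norm (y t - b t))\<^sup>2"
    using envelope_penalised_growth[OF h_convex h_lip \<mu>_pos[of t] \<beta>_pos[of t]
        z_subgradient[of t] b_eq[of t], where y = "y t"]
    unfolding y_eq[symmetric] .
  then have y: "envelope h (\<mu> t) ?y + (A *v ?x - ?y) \<bullet> z t + \<beta> t / 2 * (norm (A *v ?x - ?y))\<^sup>2
      + \<beta> t / 2 * (dy t)\<^sup>2
      \<le> envelope h (\<mu> t) (y t) + (A *v ?x - y t) \<bullet> z t + \<beta> t / 2 * (norm (A *v ?x - y t))\<^sup>2"
    unfolding square dy_def norm_minus_commute[of "y t" ?y] by linarith
  have "(A *v ?x - ?y) \<bullet> (?z - z t) = (dz t)\<^sup>2 / \<beta> t"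
    unfolding residual dz_def power2_norm_eq_inner by simp
  then have z: "(A *v ?x - ?y) \<bullet> ?z = (A *v ?x - ?y) \<bullet> z t + (dz t)\<^sup>2 / \<beta> t"
    by (simp add: inner_diff_right)
  have "\<beta> (Suc t) / 2 * (dz t / \<beta> t)\<^sup>2 \<le> (1 + \<xi>) * \<beta> t / 2 * (dz t / \<beta> t)\<^sup>2"
    by (intro mult_right_mono divide_right_mono \<beta>_ratio) auto
  then have \<beta>: "\<beta> (Suc t) / 2 * (norm (A *v ?x - ?y))\<^sup>2
      \<le> \<beta> t / 2 * (norm (A *v ?x - ?y))\<^sup>2 + \<xi> / 2 * ((dz t)\<^sup>2 / \<beta> t)"
    unfolding norm_residual using B by (simp add: field_simps power2_eq_square)
  have "\<mu> (Suc t) \<le> \<mu> t"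
    using \<beta>_mono[of t] B chi_pos by (simp add: divide_left_mono)
  then have "envelope h (\<mu> (Suc t)) ?y \<le> envelope h (\<mu> t) ?y + (\<mu> t - \<mu> (Suc t)) / 2 * C\<^sub>h\<^sup>2"
    by (intro envelope_parameter_decrease[OF h_convex h_lip \<mu>_pos])
  also have "(\<mu> t - \<mu> (Suc t)) / 2 * C\<^sub>h\<^sup>2 \<le> (\<mu> t - \<mu> (Suc t)) / 2 * z_bd\<^sup>2"
    using \<open>\<mu> (Suc t) \<le> \<mu> t\<close> C\<^sub>h_nonneg C\<^sub>h_le_z_bd by (intro mult_left_mono power_mono) auto
  also have "\<mu> t - \<mu> (Suc t) = chi * (1 / \<beta> t - 1 / \<beta> (Suc t))"
    by (simp add: right_diff_distrib)
  also have "chi * (1 / \<beta> t - 1 / \<beta> (Suc t)) / 2 * z_bd\<^sup>2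
      = chi / 2 * z_bd\<^sup>2 * (1 / \<beta> t - 1 / \<beta> (Suc t))"
    by simp
  finally have \<mu>: "envelope h (\<mu> (Suc t)) ?y \<le> envelope h (\<mu> t) ?y
      + chi / 2 * z_bd\<^sup>2 * (1 / \<beta> t - 1 / \<beta> (Suc t))" by simp
  have "(1 + \<xi> / 2) / \<beta> t * (dz t)\<^sup>2 = (dz t)\<^sup>2 / \<beta> t + \<xi> / 2 * ((dz t)\<^sup>2 / \<beta> t)"
    by (simp add: add_divide_distrib distrib_right)
  then show ?thesis
    using y z \<beta> \<mu> unfolding U_eq V_def smooth_part_def by linarith
qed

section \<open>Telescoping\<close>

definition energy :: "nat \<Rightarrow> real" where
  "energy t = (E\<^sub>x t + c_y * \<beta> t * (dy t)\<^sup>2) / d_hi"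

text \<open>Two reciprocals occur because step \<open>Suc t\<close> produces the drift from
  \<open>t\<close> to \<open>Suc t\<close>, through the multiplier, and from \<open>Suc t\<close> to
  the next index, through the smoothing. The shifted index of \<open>U\<close> avoids index 0, where
  \<open>U_le\<close> gives no bound.\<close>

definition potential :: "nat \<Rightarrow> real" where
  "potential t = U (Suc t) / d (x (Suc t)) + \<kappa> / d_lo * (1 / \<beta> t + 1 / \<beta> (Suc t))"

lemma E\<^sub>x_nonneg: "0 \<le> E\<^sub>x t"
  using \<theta>_gt_1 ell_pos[of t] by (simp add: E\<^sub>x_def)

lemma energy_nonneg: "0 \<le> energy t"
  using E\<^sub>x_nonneg[of t] c_y_pos \<beta>_pos[of t] d_hi_pos by (simp add: energy_def)

text \<open>The decrease of the \<open>x\<close>-step already refers to the new denominator, and the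
  later updates leave \<open>x\<close> unchanged, so their inequality may be divided by it. Drift is
  then bounded with \<open>d_lo\<close>, the gain with \<open>d_hi\<close>.\<close>

lemma potential_decrease: "potential (Suc t) \<le> potential t - energy (Suc t)"
proof -
  let ?T = "Suc t"
  define e where "e s = 1 / \<beta> s - 1 / \<beta> (Suc s)" for s
  have e: "0 \<le> e s" for s
    using \<beta>_mono[of s] \<beta>_pos[of s] by (simp add: e_def divide_left_mono)
  have \<kappa>e: "0 \<le> \<kappa> * (e t + e ?T)" using e[of t] e[of ?T] \<kappa>_nonneg by simp
  let ?d = "d (x (Suc ?T))"
  have d: "0 < ?d" "d_lo \<le> ?d" "?d \<le> d_hi" using d_pos bounds by blast+
  have "(2 + \<xi>) * \<xi> * z_bd\<^sup>2 * e t + chi / 2 * z_bd\<^sup>2 * e ?T \<le> \<kappa> * (e t + e ?T)"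
  proof -
    have "0 \<le> (2 + \<xi>) * \<xi> * z_bd\<^sup>2 * e ?T" "0 \<le> chi / 2 * z_bd\<^sup>2 * e t"
      using \<xi>_pos chi_pos e[of t] e[of ?T] by simp_all
    then show ?thesis unfolding \<kappa>_def distrib_left distrib_right by linarith
  qed
  moreover have "(1 / 2 - c_y) * \<beta> ?T * (dy ?T)\<^sup>2 = \<beta> ?T / 2 * (dy ?T)\<^sup>2 - c_y * \<beta> ?T * (dy ?T)\<^sup>2"
    by (simp add: algebra_simps)
  ultimately have "U (Suc ?T) \<le> V ?T + (\<kappa> * (e t + e ?T) - c_y * \<beta> ?T * (dy ?T)\<^sup>2)"
    using yz_step[of ?T] dz_squared_bound[of t] unfolding e_def by linarith
  then have "U (Suc ?T) / ?d \<le> (V ?T + (\<kappa> * (e t + e ?T) - c_y * \<beta> ?T * (dy ?T)\<^sup>2)) / ?d"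
    using d(1) by (intro divide_right_mono) auto
  then have "U (Suc ?T) / ?d \<le> V ?T / ?d + \<kappa> * (e t + e ?T) / ?d - c_y * \<beta> ?T * (dy ?T)\<^sup>2 / ?d"
    by (simp add: add_divide_distrib diff_divide_distrib)
  moreover have "V ?T / ?d \<le> U ?T / d (x ?T) - E\<^sub>x ?T / ?d" using x_step[of ?T] by blast
  moreover have "\<kappa> * (e t + e ?T) / ?d \<le> \<kappa> * (e t + e ?T) / d_lo"
    using d d_bounds \<kappa>e by (intro divide_left_mono) auto
  moreover have "energy ?T \<le> E\<^sub>x ?T / ?d + c_y * \<beta> ?T * (dy ?T)\<^sup>2 / ?d"
    unfolding energy_def add_divide_distrib[symmetric]
    using d E\<^sub>x_nonneg[of ?T] c_y_pos \<beta>_pos[of ?T] by (intro divide_left_mono) auto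
  moreover have "\<kappa> * (e t + e ?T) / d_lo
      = \<kappa> / d_lo * (1 / \<beta> t + 1 / \<beta> ?T) - \<kappa> / d_lo * (1 / \<beta> ?T + 1 / \<beta> (Suc ?T))"
    unfolding e_def by (simp add: algebra_simps add_divide_distrib diff_divide_distrib)
  ultimately show ?thesis unfolding potential_def by linarith
qed

lemma sum_energy_le: "(\<Sum>t=1..T. energy t) \<le> total"
proof -
  have "(\<Sum>t=1..T. energy t) \<le> potential 0 - potential T"
  proof (induction T)
    case (Suc T)
    then show ?case using potential_decrease[of T] by simp
  qed simp
  moreover have "0 \<le> potential T"
    using U_pos[of "Suc T"] d_pos[of "Suc T"] \<kappa>_nonneg d_bounds \<beta>_pos[of T] \<beta>_pos[of "Suc T"]
    by (simp add: potential_def)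
  moreover have "potential 0 \<le> total"
  proof -
    have "U (Suc 0) / d (x (Suc 0)) \<le> U_hi / d_lo"
      using U_le U_hi_pos d_bounds bounds(1) by (intro frac_le) auto
    moreover have "1 / \<beta> 0 + 1 / \<beta> (Suc 0) \<le> 1 / \<beta>\<^sub>0 + 1 / \<beta>\<^sub>0"
      using \<beta>_ge \<beta>\<^sub>0_pos by (intro add_mono divide_left_mono mult_pos_pos \<beta>_pos) auto
    then have "\<kappa> / d_lo * (1 / \<beta> 0 + 1 / \<beta> (Suc 0)) \<le> \<kappa> / d_lo * (1 / \<beta>\<^sub>0 + 1 / \<beta>\<^sub>0)"
      using \<kappa>_nonneg d_bounds by (intro mult_left_mono) auto
    moreover have "\<kappa> / d_lo * (1 / \<beta>\<^sub>0 + 1 / \<beta>\<^sub>0) = 2 * (\<kappa> / d_lo) / \<beta>\<^sub>0" by simp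
    ultimately show ?thesis unfolding potential_def total_def by linarith
  qed
  ultimately show ?thesis by linarith
qed

section \<open>The criticality measure and its rate\<close>

abbreviation Crit :: "nat \<Rightarrow> ereal" where
  "Crit t \<equiv> crit f \<delta> g h d A (x (Suc t)) (x t) (yc (Suc t)) (y t) (z (Suc t)) (z t)"

text \<open>The candidate takes the subgradient of \<delta> from the \<open>x\<close>-step, so
  \<open>\<zeta>\<^sub>g\<close> cancels, and the multiplier update turns the terms with the
  transpose of \<open>A\<close> into \<beta> times \<open>x\<close>- and \<open>y\<close>-steps.
  What remains are step lengths and the discrepancy of \<open>ratio_gap\<close>.\<close>

lemma stationarity_bound:
  "set_norm {\<zeta>\<^sub>\<delta> + gradient f (x (Suc (Suc t))) - \<zeta>\<^sub>g + transpose A *v z (Suc (Suc t))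
       - split_ratio f \<delta> g h d (x (Suc t)) (y (Suc t)) *\<^sub>R \<zeta>\<^sub>d
     | \<zeta>\<^sub>\<delta> \<zeta>\<^sub>g \<zeta>\<^sub>d. \<zeta>\<^sub>\<delta> \<in> limiting_subdiff \<delta> (x (Suc (Suc t))) \<and> \<zeta>\<^sub>g \<in> subdiff g (x (Suc t))
         \<and> \<zeta>\<^sub>d \<in> subdiff d (x (Suc t))}
   \<le> ereal ((1 + \<theta>) * (ell (Suc t) * dx (Suc t)) + A_norm * (\<beta> (Suc t) * dy (Suc t))
       + C\<^sub>d * (gap / d_lo) / \<beta> (Suc t))" (is "set_norm ?S \<le> ereal ?K")
proof -
  let ?t = "Suc t"
  let ?x = "x ?t" and ?x' = "x (Suc ?t)" and ?\<phi> = "split_ratio f \<delta> g h d (x ?t) (y ?t)"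
  obtain \<zeta>\<^sub>g \<zeta>\<^sub>d where g: "\<zeta>\<^sub>g \<in> subdiff g ?x" and d: "\<zeta>\<^sub>d \<in> subdiff d ?x"
    and \<delta>: "- (grad_s ?t - \<zeta>\<^sub>g - (U ?t / d ?x) *\<^sub>R \<zeta>\<^sub>d + (\<theta> * ell ?t) *\<^sub>R (?x' - ?x))
       \<in> limiting_subdiff \<delta> ?x'"
    using x_step[of ?t] .
  define v where "v = - (grad_s ?t - \<zeta>\<^sub>g - (U ?t / d ?x) *\<^sub>R \<zeta>\<^sub>d + (\<theta> * ell ?t) *\<^sub>R (?x' - ?x))
     + gradient f ?x' - \<zeta>\<^sub>g + transpose A *v z (Suc ?t) - ?\<phi> *\<^sub>R \<zeta>\<^sub>d"
  define q where "q = transpose A *v (A *v (?x' - ?x))"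
  define q' where "q' = transpose A *v (y (Suc ?t) - y ?t)"
  have "v \<in> ?S" unfolding v_def mem_Collect_eq
    by (intro exI conjI) (rule refl, rule \<delta>, rule g, rule d)
  then have "set_norm ?S \<le> ereal (norm v)"
    unfolding set_norm_def by (rule INF_lower)
  also have "norm v \<le> ?K"
  proof -
    have "transpose A *v z (Suc ?t) - (transpose A *v z ?t + \<beta> ?t *\<^sub>R (transpose A *v (A *v ?x - y ?t)))
        = \<beta> ?t *\<^sub>R (q - q')"
      unfolding z_update[of ?t] q_def q'_def
      by (simp add: matrix_vector_right_distrib matrix_vector_mult_diff_distrib matrix_vector_mult_scaleR
          scaleR_diff_right algebra_simps)
    then have v_eq: "v = (gradient f ?x' - gradient f ?x) + \<beta> ?t *\<^sub>R q - \<beta> ?t *\<^sub>R q'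
        - (\<theta> * ell ?t) *\<^sub>R (?x' - ?x) + (U ?t / d ?x - ?\<phi>) *\<^sub>R \<zeta>\<^sub>d"
      unfolding v_def gradient_smooth_part[OF f_diff[rule_format]]
      by (simp add: scaleR_diff_right scaleR_diff_left algebra_simps)
    have v: "norm v \<le> norm (gradient f ?x' - gradient f ?x) + norm (\<beta> ?t *\<^sub>R q) + norm (\<beta> ?t *\<^sub>R q')
        + norm ((\<theta> * ell ?t) *\<^sub>R (?x' - ?x)) + norm ((U ?t / d ?x - ?\<phi>) *\<^sub>R \<zeta>\<^sub>d)"
      unfolding v_eq by (rule norm_five_terms_le)
    have v1: "norm (gradient f ?x' - gradient f ?x) \<le> L\<^sub>f * dx ?t"
      using lipschitz_onD[OF f_grad, of ?x' ?x] by (simp add: dist_norm dx_def)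
    have "norm q \<le> A_norm * norm (A *v (?x' - ?x))"
      unfolding q_def by (rule norm_transpose_le)
    also have "\<dots> \<le> A_norm * (A_norm * dx ?t)"
      unfolding dx_def by (intro mult_left_mono norm_matrix_vector_le onorm_matrix_nonneg)
    finally have v2: "norm (\<beta> ?t *\<^sub>R q) \<le> \<beta> ?t * A_norm\<^sup>2 * dx ?t"
      using \<beta>_pos[of ?t] by (simp add: power2_eq_square mult.assoc)
    have "norm q' \<le> A_norm * dy ?t"
      unfolding q'_def dy_def by (rule norm_transpose_le)
    then have v3: "norm (\<beta> ?t *\<^sub>R q') \<le> A_norm * (\<beta> ?t * dy ?t)"
      using \<beta>_pos[of ?t] by (simp add: mult.left_commute)
    have v4: "norm ((\<theta> * ell ?t) *\<^sub>R (?x' - ?x)) = \<theta> * (ell ?t * dx ?t)"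
      using \<theta>_gt_1 ell_pos[of ?t] by (simp add: dx_def)
    have "norm ((U ?t / d ?x - ?\<phi>) *\<^sub>R \<zeta>\<^sub>d) \<le> gap / d_lo / \<beta> ?t * C\<^sub>d"
      unfolding norm_scaleR
      using ratio_gap[of t] subgradient_lipschitz[OF d_lip d] by (intro mult_mono) auto
    then have v5: "norm ((U ?t / d ?x - ?\<phi>) *\<^sub>R \<zeta>\<^sub>d) \<le> C\<^sub>d * (gap / d_lo) / \<beta> ?t"
      by (simp add: mult.commute)
    have "L\<^sub>f * dx ?t + \<beta> ?t * A_norm\<^sup>2 * dx ?t \<le> ell ?t * dx ?t"
      unfolding ell_def distrib_right using w_pos[of ?t] W_nonneg by (simp add: dx_def)
    then show ?thesis
      using v v1 v2 v3 v4 v5 by (simp add: distrib_right)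
  qed
  finally show ?thesis by simp
qed

text \<open>The multiplier is an exact subgradient of \<open>h\<close> at \<open>yc\<close>, so the
  term for \<open>h\<close> is 0. Passing between \<open>yc\<close> and \<open>y\<close> costs \<mu>
  times the norm of the multiplier, of order \<open>1 / \<beta>\<close>.\<close>

lemma Crit_le:
  "Crit (Suc t) \<le> ereal (k_x * (ell (Suc t) * dx (Suc t)) + k_y * (\<beta> (Suc t) * dy (Suc t)) + k_0 / \<beta> (Suc t))"
proof -
  let ?t = "Suc t"
  let ?B = "\<beta> ?t"
  have B: "0 < ?B" by (rule \<beta>_pos)
  have c1: "norm (x (Suc ?t) - x ?t) \<le> 1 / ell_lo * (ell ?t * dx ?t)"
  proof -
    have "ell_lo * dx ?t \<le> ell ?t * dx ?t" by (intro mult_right_mono ell_ge) (simp add: dx_def)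
    then show ?thesis using ell_lo_pos by (simp add: dx_def field_simps)
  qed
  have \<mu>z: "norm (\<mu> ?t *\<^sub>R z (Suc ?t)) \<le> chi * z_bd / ?B"
    using norm_z_le[of "Suc ?t"] chi_pos B by (simp add: field_simps)
  have c2: "norm (yc (Suc ?t) - y ?t) \<le> 1 / \<beta>\<^sub>0 * (?B * dy ?t) + chi * z_bd / ?B"
  proof -
    have "yc (Suc ?t) - y ?t = (y (Suc ?t) - y ?t) - \<mu> ?t *\<^sub>R z (Suc ?t)" by (simp add: y_eq)
    then have "norm (yc (Suc ?t) - y ?t) \<le> dy ?t + norm (\<mu> ?t *\<^sub>R z (Suc ?t))"
      unfolding dy_def by (simp only: norm_triangle_ineq4)
    moreover have "\<beta>\<^sub>0 * dy ?t \<le> ?B * dy ?t" by (intro mult_right_mono \<beta>_ge) (simp add: dy_def)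
    then have "dy ?t \<le> 1 / \<beta>\<^sub>0 * (?B * dy ?t)" using \<beta>\<^sub>0_pos by (simp add: field_simps)
    ultimately show ?thesis using \<mu>z by linarith
  qed
  have c3: "norm (z (Suc ?t) - z ?t) \<le> 1 / chi * (?B * dy ?t) + (1 + \<xi>) * \<xi> * \<beta>\<^sub>0 * z_bd / ?B"
  proof -
    \<comment> \<open>The increments of the penalty are bounded, so this drift is of order
      \<open>1 / \<beta>\<close> and not merely bounded by \<xi>.\<close>
    have "?B * (1 / \<beta> t - 1 / ?B) = (?B - \<beta> t) * (1 / \<beta> t)"
      using B \<beta>_pos[of t] by (simp add: field_simps)
    also have "\<dots> \<le> (\<xi> * \<beta>\<^sub>0) * ((1 + \<xi>) / ?B)"
      using \<beta>_increment[of t] \<beta>_pos[of t] \<xi>_pos \<beta>\<^sub>0_pos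
      by (intro mult_mono inverse_\<beta>_ratio) auto
    finally have "z_bd * (?B * (1 / \<beta> t - 1 / ?B)) \<le> z_bd * ((\<xi> * \<beta>\<^sub>0) * ((1 + \<xi>) / ?B))"
      by (intro mult_left_mono z_bd_nonneg)
    also have "\<dots> = (1 + \<xi>) * \<xi> * \<beta>\<^sub>0 * z_bd / ?B" by simp
    finally show ?thesis using dz_bound[of t] by (simp add: dz_def)
  qed
  have c4: "norm (A *v x (Suc ?t) - yc (Suc ?t)) \<le> (2 + chi) * z_bd / ?B"
  proof -
    have "A *v x (Suc ?t) - yc (Suc ?t) = (A *v x (Suc ?t) - y (Suc ?t)) + \<mu> ?t *\<^sub>R z (Suc ?t)"
      by (simp add: y_eq)
    then have "norm (A *v x (Suc ?t) - yc (Suc ?t))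
        \<le> norm (A *v x (Suc ?t) - y (Suc ?t)) + norm (\<mu> ?t *\<^sub>R z (Suc ?t))"
      by (simp only: norm_triangle_ineq)
    also have "\<dots> \<le> 2 * z_bd / ?B + chi * z_bd / ?B"
      by (intro add_mono residual_small \<mu>z)
    finally show ?thesis by (simp add: distrib_right add_divide_distrib)
  qed
  have c5: "set_norm {\<zeta>\<^sub>h - z (Suc ?t) | \<zeta>\<^sub>h. \<zeta>\<^sub>h \<in> subdiff h (yc (Suc ?t))} \<le> ereal 0"
  proof -
    have "z (Suc ?t) - z (Suc ?t) \<in> {\<zeta>\<^sub>h - z (Suc ?t) | \<zeta>\<^sub>h. \<zeta>\<^sub>h \<in> subdiff h (yc (Suc ?t))}"
      using convex_subgradient_imp_subdiff[OF z_subgradient] by blast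
    then have "set_norm {\<zeta>\<^sub>h - z (Suc ?t) | \<zeta>\<^sub>h. \<zeta>\<^sub>h \<in> subdiff h (yc (Suc ?t))}
        \<le> ereal (norm (z (Suc ?t) - z (Suc ?t)))"
      unfolding set_norm_def by (rule INF_lower)
    then show ?thesis by simp
  qed
  have "Crit ?t \<le> ereal (1 / ell_lo * (ell ?t * dx ?t)) + ereal (1 / \<beta>\<^sub>0 * (?B * dy ?t) + chi * z_bd / ?B)
      + ereal (1 / chi * (?B * dy ?t) + (1 + \<xi>) * \<xi> * \<beta>\<^sub>0 * z_bd / ?B)
      + ereal ((2 + chi) * z_bd / ?B) + ereal 0
      + ereal ((1 + \<theta>) * (ell ?t * dx ?t) + A_norm * (?B * dy ?t) + C\<^sub>d * (gap / d_lo) / ?B)"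
    unfolding crit_def
    by (intro add_mono c5 stationarity_bound; simp only: ereal_less_eq c1 c2 c3 c4)
  also have "\<dots> = ereal (k_x * (ell ?t * dx ?t) + k_y * (?B * dy ?t) + k_0 / ?B)"
    by (simp add: k_x_def k_y_def k_0_def algebra_simps add_divide_distrib)
  finally show ?thesis .
qed

text \<open>Each square is a term of the energy times a spare factor \<open>ell\<close> or \<beta>,
  and that factor grows at most like \<open>t powr p\<close>.\<close>

lemma step_bound:
  "(k_x * (ell (Suc t) * dx (Suc t)) + k_y * (\<beta> (Suc t) * dy (Suc t)))\<^sup>2
     \<le> M * energy (Suc t) * real (Suc t) powr p"
proof -
  let ?t = "Suc t"
  define P where "P = real ?t powr p"
  define X Y where "X = ell ?t * (dx ?t)\<^sup>2" and "Y = \<beta> ?t * (dy ?t)\<^sup>2"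
  have P: "0 \<le> P" by (simp add: P_def)
  have X: "0 \<le> X" using ell_pos[of ?t] by (simp add: X_def)
  have Y: "0 \<le> Y" using \<beta>_pos[of ?t] by (simp add: Y_def)
  have "(k_x * (ell ?t * dx ?t) + k_y * (\<beta> ?t * dy ?t))\<^sup>2
      \<le> 2 * (k_x * (ell ?t * dx ?t))\<^sup>2 + 2 * (k_y * (\<beta> ?t * dy ?t))\<^sup>2"
    using zero_le_power2[of "k_x * (ell ?t * dx ?t) - k_y * (\<beta> ?t * dy ?t)"]
    unfolding power2_sum power2_diff by linarith
  also have "\<dots> = 2 * k_x\<^sup>2 * (ell ?t * X) + 2 * k_y\<^sup>2 * (\<beta> ?t * Y)"
    by (simp add: X_def Y_def power2_eq_square)
  also have "\<dots> \<le> 2 * k_x\<^sup>2 * (ell_hi * P * X) + 2 * k_y\<^sup>2 * (\<beta>\<^sub>0 * (1 + \<xi>) * P * Y)"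
    unfolding P_def by (intro add_mono mult_left_mono mult_right_mono ell_le \<beta>_upper X Y) auto
  also have "\<dots> \<le> M * energy ?t * P"
  proof -
    define a b where "a = 2 * k_x\<^sup>2 * ell_hi" and "b = 2 * k_y\<^sup>2 * (\<beta>\<^sub>0 * (1 + \<xi>))"
    have ab: "0 \<le> a" "0 \<le> b" using ell_hi_nonneg \<beta>\<^sub>0_pos \<xi>_pos by (simp_all add: a_def b_def)
    have th: "0 < \<theta> - 1" using \<theta>_gt_1 by simp
    have "M * energy ?t = (a * 2 / (\<theta> - 1) + b / c_y) * ((\<theta> - 1) / 2 * X + c_y * Y)"
      using d_hi_pos unfolding M_def energy_def E\<^sub>x_def X_def Y_def a_def b_def
      by (simp add: mult.assoc)
    \<comment> \<open>The coefficients in \<open>M\<close> invert the weights of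
      \<open>energy\<close>; the cross terms are nonnegative and get dropped.\<close>
    also have "\<dots> = a * X + b * Y + (a * 2 / (\<theta> - 1) * (c_y * Y) + b / c_y * ((\<theta> - 1) / 2 * X))"
      using th c_y_pos by (simp add: distrib_left distrib_right)
    finally have "a * X + b * Y \<le> M * energy ?t"
      using ab X Y th c_y_pos by simp
    then have "(a * X + b * Y) * P \<le> M * energy ?t * P" using P by (rule mult_right_mono)
    then show ?thesis by (simp add: a_def b_def algebra_simps)
  qed
  finally show ?thesis unfolding P_def .
qed

lemma Crit_rate:
  assumes T: "1 \<le> T"
  shows "\<exists>t\<in>{1..T}. Crit t \<le> ereal (K\<^sub>1 * real T powr (- p) + K\<^sub>2 * real T powr ((p - 1) / 2))"
proof -
  obtain t where t: "1 \<le> t" "t \<le> T" "T \<le> 2 * t" "energy t \<le> 2 * total / real T"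
    using small_term_in_second_half[OF T sum_energy_le energy_nonneg] by blast
  then obtain s where s: "t = Suc s" by (cases t) auto
  have Tp: "0 < real T powr p" using T by simp
  let ?E = "k_x * (ell t * dx t) + k_y * (\<beta> t * dy t)"
  have "?E\<^sup>2 \<le> M * energy t * real t powr p"
    unfolding s by (rule step_bound)
  also have "\<dots> \<le> M * (2 * total / real T) * real T powr p"
    using t M_nonneg total_pos p_pos
    by (intro mult_mono mult_left_mono powr_mono2 mult_nonneg_nonneg) auto
  also have "\<dots> = 2 * M * total * (real T powr ((p - 1) / 2))\<^sup>2"
  proof -
    have "(real T powr ((p - 1) / 2))\<^sup>2 = real T powr (p - 1)"
      by (simp add: power2_eq_square powr_add[symmetric])
    also have "\<dots> = real T powr p / real T" using T by (simp add: powr_diff)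
    finally show ?thesis by simp
  qed
  finally have "sqrt (?E\<^sup>2) \<le> sqrt (2 * M * total * (real T powr ((p - 1) / 2))\<^sup>2)"
    by (rule real_sqrt_le_mono)
  then have "?E \<le> sqrt (2 * M * total) * real T powr ((p - 1) / 2)"
    unfolding real_sqrt_mult[of "2 * M * total"] real_sqrt_abs by simp
  also have "\<dots> \<le> K\<^sub>2 * real T powr ((p - 1) / 2)"
    by (intro mult_right_mono) (simp_all add: K\<^sub>2_def)
  finally have E: "?E \<le> K\<^sub>2 * real T powr ((p - 1) / 2)" .
  have "k_0 / \<beta> t \<le> k_0 / (\<beta>\<^sub>0 * \<xi> * (real T powr p / 2 powr p))"
  proof (rule divide_left_mono)
    have "real T powr p / 2 powr p = (real T / 2) powr p" by (simp add: powr_divide)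
    also have "\<dots> \<le> real t powr p" using t p_pos by (intro powr_mono2) auto
    finally have "\<beta>\<^sub>0 * \<xi> * (real T powr p / 2 powr p) \<le> \<beta>\<^sub>0 * \<xi> * real t powr p"
      using \<beta>\<^sub>0_pos \<xi>_pos by (intro mult_left_mono) auto
    then show "\<beta>\<^sub>0 * \<xi> * (real T powr p / 2 powr p) \<le> \<beta> t" using \<beta>_lower[of t] by linarith
  qed (use k_0_nonneg \<beta>_pos[of t] \<beta>\<^sub>0_pos \<xi>_pos Tp in auto)
  also have "\<dots> = k_0 * 2 powr p / (\<beta>\<^sub>0 * \<xi>) * real T powr (- p)"
    by (simp add: powr_minus field_simps)
  also have "\<dots> \<le> K\<^sub>1 * real T powr (- p)"
    by (intro mult_right_mono) (simp_all add: K\<^sub>1_def)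
  finally have "?E + k_0 / \<beta> t \<le> K\<^sub>1 * real T powr (- p) + K\<^sub>2 * real T powr ((p - 1) / 2)"
    using E by linarith
  with Crit_le[of s] have "Crit t \<le> ereal (K\<^sub>1 * real T powr (- p) + K\<^sub>2 * real T powr ((p - 1) / 2))"
    unfolding s[symmetric] by (meson ereal_less_eq(3) order_trans)
  then show ?thesis using t by auto
qed

end

text \<open>The order of quantifiers encodes that the constants depend on neither the run nor
  \<open>T\<close> nor \<epsilon>. The bound is asserted for a suitable index in
  \<open>{1..T}\<close>.\<close>

theorem theorem6p3:
  fixes f g d :: "real^'n \<Rightarrow> real" and \<delta> :: "real^'n \<Rightarrow> ereal" and h :: "real^'m \<Rightarrow> real"
    and A :: "real^'n^'m"
    and L\<^sub>f C\<^sub>h C\<^sub>d W\<^sub>d x_bd \<xi> \<theta> p chi \<beta>\<^sub>0 d_lo d_hi F_lo F_hi :: real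
    and var :: fadmm_variant
    and x0 :: "real^'n" and y0 z0 :: "real^'m"
  assumes f_diff: "\<forall>x. f differentiable (at x)"
    and f_grad: "L\<^sub>f-lipschitz_on UNIV (gradient f)"
    and \<delta>_proper: "proper_fun \<delta>" and \<delta>_lsc: "lower_semicont \<delta>"
    and g_convex: "convex_on UNIV g"
    and h_convex: "convex_on UNIV h" and h_lip: "C\<^sub>h-lipschitz_on UNIV h"
    and d_nonneg: "\<forall>x. 0 \<le> d x" and d_lip: "C\<^sub>d-lipschitz_on UNIV d"
    and u_nonneg: "\<forall>x. 0 \<le> numer f \<delta> g h A x"
    and dom_bounded: "0 < x_bd" "\<forall>x. frac_obj f \<delta> g h d A x < \<infinity> \<longrightarrow> norm x \<le> x_bd"
    and W_nonneg: "0 \<le> W\<^sub>d"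
    and weak_D: "var = FADMM_D \<Longrightarrow> weakly_convex W\<^sub>d d"
    and weak_Q: "var = FADMM_Q \<Longrightarrow> weakly_convex W\<^sub>d (\<lambda>x. sqrt (d x))"
    and nondegenerate: "A \<noteq> 0 \<or> 0 < L\<^sub>f \<or> 0 < W\<^sub>d"
    and params: "0 < \<xi>" "1 < \<theta>" "0 < p" "p < 1" "2 * sqrt (1 + \<xi>) < chi" "0 < \<beta>\<^sub>0"
    and start: "frac_obj f \<delta> g h d A x0 < \<infinity>"
    and bounds_pos: "0 < d_lo" "0 < F_lo"
    and \<beta>\<^sub>0_large: "\<beta>\<^sub>0 > (8 * (max (norm z0) C\<^sub>h)\<^sup>2 + 1 / 2 * chi * (max (norm z0) C\<^sub>h)\<^sup>2) / (F_lo * d_lo)"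
  shows "\<exists>K\<^sub>1 > 0. \<exists>K\<^sub>2 > 0. \<exists>K\<^sub>3 > 0. \<exists>K\<^sub>4 > 0.
    \<forall>(x :: nat \<Rightarrow> real^'n) (yc :: nat \<Rightarrow> real^'m) (y :: nat \<Rightarrow> real^'m) (z :: nat \<Rightarrow> real^'m).
      x 0 = x0 \<and> y 0 = y0 \<and> z 0 = z0 \<and>
      fadmm_run var f \<delta> g h d A L\<^sub>f W\<^sub>d \<theta> \<xi> p chi \<beta>\<^sub>0 x yc y z \<and>
      (\<forall>t. d_lo \<le> d (x t) \<and> d (x t) \<le> d_hi \<and>
           ereal F_lo \<le> frac_obj f \<delta> g h d A (x t) \<and> frac_obj f \<delta> g h d A (x t) \<le> ereal F_hi)
      \<longrightarrow>
      (let Crit = (\<lambda>t. crit f \<delta> g h d A (x (Suc t)) (x t) (yc (Suc t)) (y t) (z (Suc t)) (z t))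
       in (\<forall>T\<ge>1. \<exists>t\<in>{1..T}.
             Crit t \<le> ereal (K\<^sub>1 * real T powr (- p) + K\<^sub>2 * real T powr ((p - 1) / 2))) \<and>
          (p = 1 / 3 \<longrightarrow>
             (\<forall>T\<ge>1. \<exists>t\<in>{1..T}. Crit t \<le> ereal (K\<^sub>3 * real T powr (- 1 / 3))) \<and>
             (\<forall>\<epsilon>>0. \<forall>T\<ge>1. real T \<ge> K\<^sub>4 / \<epsilon> ^ 3 \<longrightarrow> (\<exists>t\<in>{1..T}. Crit t \<le> ereal \<epsilon>))))"
proof -
  define valid where "valid x yc y z \<longleftrightarrow> x 0 = x0 \<and> y 0 = y0 \<and> z 0 = z0 \<and>
      fadmm_run var f \<delta> g h d A L\<^sub>f W\<^sub>d \<theta> \<xi> p chi \<beta>\<^sub>0 x yc y z \<and>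
      (\<forall>t. d_lo \<le> d (x t) \<and> d (x t) \<le> d_hi \<and>
           ereal F_lo \<le> frac_obj f \<delta> g h d A (x t) \<and> frac_obj f \<delta> g h d A (x t) \<le> ereal F_hi)"
    for x yc y z
  show ?thesis
  \<comment> \<open>Without an admissible run the claim is vacuous; any such run yields
    \<open>d_lo \<le> d_hi\<close> and \<open>F_lo \<le> F_hi\<close>, on which the signs of the
    constants rely.\<close>
  proof (cases "\<exists>x yc y z. valid x yc y z")
    case False
    then show ?thesis unfolding valid_def by (intro exI[of _ "1::real"] conjI zero_less_one) blast
  next
    case True
    then obtain x yc y z where "valid x yc y z" by blast
    then have order: "d_lo \<le> d_hi" "ereal F_lo \<le> ereal F_hi"
      unfolding valid_def by (meson order_trans)+
    have "weakly_convex W\<^sub>d (denom_part var d)"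
      using weak_D weak_Q by (cases var) (simp_all add: denom_part_def)
    then interpret fadmm_setting f g d \<delta> h A L\<^sub>f C\<^sub>h C\<^sub>d W\<^sub>d \<xi> \<theta> p chi \<beta>\<^sub>0 d_lo d_hi F_lo F_hi var z0
      using assms order by unfold_locales simp_all
    let ?K = "K\<^sub>1 + K\<^sub>2"
    have rates: "(\<forall>T\<ge>1. \<exists>t\<in>{1..T}. Crit t \<le> ereal (K\<^sub>1 * real T powr (- p) + K\<^sub>2 * real T powr ((p - 1) / 2))) \<and>
        (p = 1 / 3 \<longrightarrow> (\<forall>T\<ge>1. \<exists>t\<in>{1..T}. Crit t \<le> ereal (?K * real T powr (- 1 / 3))) \<and>
           (\<forall>\<epsilon>>0. \<forall>T\<ge>1. real T \<ge> ?K ^ 3 / \<epsilon> ^ 3 \<longrightarrow> (\<exists>t\<in>{1..T}. Crit t \<le> ereal \<epsilon>)))"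
      if "valid x yc y z"
        and Crit: "Crit = (\<lambda>t. crit f \<delta> g h d A (x (Suc t)) (x t) (yc (Suc t)) (y t) (z (Suc t)) (z t))"
      for x yc y z Crit
    proof -
      interpret fadmm_iterates f g d \<delta> h A L\<^sub>f C\<^sub>h C\<^sub>d W\<^sub>d \<xi> \<theta> p chi \<beta>\<^sub>0 d_lo d_hi F_lo F_hi var z0 x yc y z
        using that(1) unfolding valid_def by unfold_locales simp_all
      have rate: "\<exists>t\<in>{1..T}. Crit t \<le> ereal (K\<^sub>1 * real T powr (- p) + K\<^sub>2 * real T powr ((p - 1) / 2))"
        if "1 \<le> T" for T
        unfolding Crit by (rule Crit_rate[OF that])
      have third: "\<exists>t\<in>{1..T}. Crit t \<le> ereal (?K * real T powr (- 1 / 3))"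
        if "p = 1 / 3" "1 \<le> T" for T
      proof -
        \<comment> \<open>\<open>p = 1 / 3\<close> balances the two rates: it solves
          \<open>p = (1 - p) / 2\<close>.\<close>
        have "- p = - 1 / 3" "(p - 1) / 2 = - 1 / 3" using that(1) by simp_all
        then show ?thesis using rate[OF that(2)] by (simp only: distrib_right)
      qed
      have "\<exists>t\<in>{1..T}. Crit t \<le> ereal \<epsilon>"
        if "p = 1 / 3" "0 < \<epsilon>" "1 \<le> T" "?K ^ 3 / \<epsilon> ^ 3 \<le> real T" for \<epsilon> T
      proof -
        have "?K * real T powr (- 1 / 3) \<le> \<epsilon>"
          by (rule cube_root_rate_le[OF add_pos_pos[OF K_pos] that(2-4)])
        then show ?thesis
          using third[OF that(1,3)] by (meson ereal_less_eq(3) order_trans)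
      qed
      with rate third show ?thesis by blast
    qed
    \<comment> \<open>\<open>?K ^ 3\<close> becomes the witness for \<open>K\<^sub>4\<close>, since
      \<open>?K * T powr (- 1 / 3) \<le> \<epsilon>\<close> amounts to
      \<open>T \<ge> ?K ^ 3 / \<epsilon> ^ 3\<close>.\<close>
    have "0 < ?K" "0 < ?K ^ 3" using K_pos by simp_all
    then show ?thesis
      unfolding Let_def valid_def[symmetric]
      by (intro exI[of _ K\<^sub>1] exI[of _ K\<^sub>2] exI[of _ ?K] exI[of _ "?K ^ 3"] conjI K_pos allI impI)
        (use rates[OF _ refl] in \<open>simp_all only:\<close>)
  qed
qed

end
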